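(* For every integer $n\ge 0$, $$s(25n) - 5 s(n) = 4\,(2,2,2,-1,1,1)(n) - 8\,(7,8,8,-4,8,8)(n).$$
   Context: For integers $a,b,c,d,e,f$, $(a,b,c,d,e,f)(n)$ denotes the number of representations of $n$ by the ternary quadratic form $ax^2+by^2+cz^2+dyz+ezx+fxy$, i.e. the number of triples $(x,y,z)\in\mathbb{Z}^3$ with $ax^2+by^2+cz^2+dyz+ezx+fxy=n$. In particular $(2,2,2,-1,1,1)(n)$ counts $(x,y,z)\in\mathbb{Z}^3$ with $2x^2+2y^2+2z^2-yz+zx+xy=n$, and $(7,8,8,-4,8,8)(n)$ counts those with $7x^2+8y^2+8z^2-4yz+8zx+8xy=n$. $s(n)$ denotes the number of triples $(x,y,z)\in\mathbb{Z}^3$ with $x^2+y^2+z^2=n$. *)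

theory Defs
  imports Complex_Main
begin

definition ternary_form :: "int \<Rightarrow> int \<Rightarrow> int \<Rightarrow> int \<Rightarrow> int \<Rightarrow> int \<Rightarrow> int \<times> int \<times> int \<Rightarrow> int" where
  "ternary_form a b c d e f = (\<lambda>(x, y, z).
     a * x\<^sup>2 + b * y\<^sup>2 + c * z\<^sup>2 + d * y * z + e * z * x + f * x * y)"

text \<open>The count is meaningful when the solution set is finite, in particular for every
  positive definite form; \<^const>\<open>card\<close> returns 0 on infinite sets.\<close>

definition rep_count :: "int \<Rightarrow> int \<Rightarrow> int \<Rightarrow> int \<Rightarrow> int \<Rightarrow> int \<Rightarrow> int \<Rightarrow> nat" where
  "rep_count a b c d e f n = card {v. ternary_form a b c d e f v = n}"

definition sum3sq_count :: "int \<Rightarrow> nat" where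
  "sum3sq_count n = card {(x :: int, y :: int, z :: int). x\<^sup>2 + y\<^sup>2 + z\<^sup>2 = n}"

end

theory Submission
  imports Defs "HOL-Analysis.Analysis"
begin

text \<open>
  Write \<open>\<theta>\<^sub>2, \<theta>\<^sub>3, \<theta>\<^sub>4\<close> for Jacobi's theta constants. Dissecting theta series modulo 5 gives
  \<open>s(25 n) = 7 s(n) - 6 (1,5,5,0,0,0)(n)\<close>, and completing squares turns the generating functions of the two
  other forms into sums of theta products, so that the claim becomes the identity
  \<open>\<theta>\<^sub>3(q)^3 - 3 \<theta>\<^sub>3(q) \<theta>\<^sub>3(q^5)^2 =
    \<theta>\<^sub>2(q^(1/2)) \<theta>\<^sub>2(q^(5/2)) \<theta>\<^sub>2(q^5) - 2 \<theta>\<^sub>4(q^2) \<theta>\<^sub>4(q^10) \<theta>\<^sub>4(q^5)\<close>.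
  Put \<open>t\<^sub>i = \<theta>\<^sub>i(q)\<close>, \<open>s\<^sub>i = \<theta>\<^sub>i(q^5)\<close>. Lattice arguments in \<open>\<int>\<^sup>2\<close> (multiplication by \<open>2 - i\<close>) and
  in \<open>\<int>\<^sup>5\<close> (translation along the diagonal) give \<open>(t\<^sub>i\<^sup>2 - s\<^sub>i\<^sup>2)\<^sup>2 s\<^sub>i = K t\<^sub>i\<close> with the same \<open>K\<close> for
  \<open>i = 2, 3, 4\<close>. Together with Jacobi's \<open>\<theta>\<^sub>2^4 + \<theta>\<^sub>4^4 = \<theta>\<^sub>3^4\<close> at \<open>q\<close> and \<open>q^5\<close>, this yields two
  equations between the ratios \<open>r\<^sub>i = t\<^sub>i / s\<^sub>i\<close>. For small \<open>q > 0\<close> a monotonicity argument shows that they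
  have a unique solution \<open>(r\<^sub>2, r\<^sub>4)\<close> for given \<open>r\<^sub>3\<close>, which can be written down explicitly, and the
  identity can be read off from it.
\<close>

section \<open>Theta series\<close>

lemma has_sum_reindexI:
  assumes "(h has_sum s) T"
    and "\<And>a. a \<in> S \<Longrightarrow> i (j a) = a" "\<And>a. a \<in> S \<Longrightarrow> j a \<in> T"
    and "\<And>b. b \<in> T \<Longrightarrow> j (i b) = b" "\<And>b. b \<in> T \<Longrightarrow> i b \<in> S"
    and "\<And>a. a \<in> S \<Longrightarrow> h (j a) = g a"
  shows "(g has_sum s) S"
  using has_sum_reindex_bij_witness[of S i j T h g s s] assms by auto

text \<open>For real families summability coincides with absolute summability, so the absolute
  values form a product of two convergent nonnegative families. This makes the product family
  summable, and its sum can be taken row by row.\<close>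

lemma has_sum_times:
  fixes f :: "'a \<Rightarrow> real" and g :: "'b \<Rightarrow> real"
  assumes f: "(f has_sum a) A" and g: "(g has_sum b) B"
  shows "((\<lambda>(x, y). f x * g y) has_sum a * b) (A \<times> B)"
proof -
  have "(\<lambda>x. \<bar>f x\<bar>) summable_on A" "(\<lambda>y. \<bar>g y\<bar>) summable_on B"
    using f g has_sum_imp_summable summable_on_iff_abs_summable_on_real[of f A]
      summable_on_iff_abs_summable_on_real[of g B] by auto
  then obtain a' b' where f': "((\<lambda>x. \<bar>f x\<bar>) has_sum a') A" and g': "((\<lambda>y. \<bar>g y\<bar>) has_sum b') B"
    by (auto simp: summable_on_def)
  have "(\<lambda>(x, y). \<bar>f x\<bar> * \<bar>g y\<bar>) summable_on A \<times> B"
    by (rule summable_on_SigmaI[where g = "\<lambda>x. \<bar>f x\<bar> * b'"])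
      (auto intro: has_sum_cmult_right[OF g'] has_sum_imp_summable[OF has_sum_cmult_left[OF f']])
  then have "(\<lambda>z. norm (case z of (x, y) \<Rightarrow> f x * g y)) summable_on A \<times> B"
    by (simp add: case_prod_unfold abs_mult)
  then have "(\<lambda>(x, y). f x * g y) summable_on A \<times> B"
    by (rule abs_summable_summable)
  then show ?thesis
    by (intro has_sum_SigmaI[where g = "\<lambda>x. f x * b"])
      (auto intro: has_sum_cmult_right[OF g] has_sum_cmult_left[OF f])
qed

text \<open>The weight \<open>f\<close> may be a sign, a character or the indicator of a residue
  class. One convergence proof and one tail estimate then serve all series below.\<close>

definition theta :: "(int \<Rightarrow> real) \<Rightarrow> real \<Rightarrow> real" where
  "theta f a = infsum (\<lambda>n. f n * a powi n\<^sup>2) UNIV"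

definition unit_bounded :: "(int \<Rightarrow> real) \<Rightarrow> bool" where
  "unit_bounded f \<longleftrightarrow> (\<forall>n. \<bar>f n\<bar> \<le> 1)"

lemma unit_boundedD: "unit_bounded f \<Longrightarrow> \<bar>f n\<bar> \<le> 1"
  by (simp add: unit_bounded_def)

lemma has_sum_power_tail:
  fixes a :: real
  assumes "0 < a" "a < 1" "N > 0"
  shows "((\<lambda>n::int. a ^ nat \<bar>n\<bar>) has_sum (2 * a ^ N / (1 - a))) {n. int N \<le> \<bar>n\<bar>}"
proof -
  have "(\<lambda>n. a ^ n) sums (1 / (1 - a))"
    using assms by (intro geometric_sums) auto
  then have "(\<lambda>n. a ^ N * a ^ n) sums (a ^ N * (1 / (1 - a)))"
    by (rule sums_mult)
  then have "(\<lambda>n. a ^ (N + n)) sums (a ^ N / (1 - a))"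
    by (simp add: power_add)
  then have "((\<lambda>n. a ^ (N + n)) has_sum (a ^ N / (1 - a))) UNIV"
    using assms by (intro sums_nonneg_imp_has_sum) auto
  then have P: "((\<lambda>n::int. a ^ nat \<bar>n\<bar>) has_sum (a ^ N / (1 - a))) {n. int N \<le> n}"
    by (rule has_sum_reindexI[where i = "\<lambda>n. int (N + n)" and j = "\<lambda>n. nat n - N"]) auto
  then have M: "((\<lambda>n::int. a ^ nat \<bar>n\<bar>) has_sum (a ^ N / (1 - a))) {n. int N \<le> -n}"
    by (rule has_sum_reindexI[where i = uminus and j = uminus]) auto
  have "{n. int N \<le> \<bar>n\<bar>} = {n. int N \<le> n} \<union> {n. int N \<le> -n}"
    by auto
  moreover have "{n. int N \<le> n} \<inter> {n. int N \<le> -n} = {}"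
    using assms(3) by auto
  ultimately show ?thesis
    using has_sum_Un_disjoint[OF P M] by simp
qed

text \<open>Writing |n| = N + d gives n^2 >= N^2 + d = (N^2 - N) + |n|. The quadratic exponent
  becomes linear, as a geometric majorant requires, while the prefactor keeps the whole tail of
  order a^(N^2).\<close>

lemma theta_term_bound:
  assumes "unit_bounded f" "0 < a" "a < 1" "int N \<le> \<bar>n\<bar>" "N > 0"
  shows "\<bar>f n * a powi n\<^sup>2\<bar> \<le> a ^ (N\<^sup>2 - N) * a ^ nat \<bar>n\<bar>"
proof -
  have "\<bar>f n * a powi n\<^sup>2\<bar> \<le> a powi n\<^sup>2"
    using unit_boundedD[OF assms(1), of n] assms
    by (simp add: abs_mult mult_left_le_one_le)
  also have "a powi n\<^sup>2 = a powi int ((nat \<bar>n\<bar>)\<^sup>2)"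
    by simp
  also have "\<dots> = a ^ (nat \<bar>n\<bar>)\<^sup>2"
    by (rule power_int_of_nat)
  also have "\<dots> \<le> a ^ ((N\<^sup>2 - N) + nat \<bar>n\<bar>)"
  proof (rule power_decreasing)
    have "N \<le> nat \<bar>n\<bar>" using assms by simp
    then obtain d where d: "nat \<bar>n\<bar> = N + d" using le_Suc_ex by blast
    have "d \<le> N * d" using assms(5) by simp
    then have "N\<^sup>2 + d \<le> (N + d)\<^sup>2"
      unfolding power2_eq_square distrib_left distrib_right by linarith
    moreover have "N \<le> N\<^sup>2"
      by (simp add: power2_eq_square)
    ultimately show "N\<^sup>2 - N + nat \<bar>n\<bar> \<le> (nat \<bar>n\<bar>)\<^sup>2"
      unfolding d by simp
  qed (use assms in auto)
  finally show ?thesis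
    by (simp add: power_add)
qed

lemma theta_summable:
  assumes "unit_bounded f" "0 < a" "a < 1"
  shows "(\<lambda>n. f n * a powi n\<^sup>2) summable_on UNIV"
proof -
  have "(\<lambda>n. norm (f n * a powi n\<^sup>2)) summable_on {n. int 1 \<le> \<bar>n\<bar>}"
  proof (rule summable_on_comparison_test)
    show "(\<lambda>n::int. a ^ nat \<bar>n\<bar>) summable_on {n. int 1 \<le> \<bar>n\<bar>}"
      by (rule has_sum_imp_summable[OF has_sum_power_tail[OF assms(2,3), where N = 1]]) simp
    show "norm (f n * a powi n\<^sup>2) \<le> a ^ nat \<bar>n\<bar>" if "n \<in> {n. int 1 \<le> \<bar>n\<bar>}" for n
      using theta_term_bound[OF assms, where N = 1 and n = n] that by simp
  qed simp
  then have "(\<lambda>n. f n * a powi n\<^sup>2) summable_on {n. int 1 \<le> \<bar>n\<bar>}"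
    by (rule abs_summable_summable)
  then have "(\<lambda>n. f n * a powi n\<^sup>2) summable_on insert 0 {n. int 1 \<le> \<bar>n\<bar>}"
    by (subst summable_on_insert_iff) simp
  moreover have "insert 0 {n. int 1 \<le> \<bar>n\<bar>} = UNIV"
    by auto
  ultimately show ?thesis by simp
qed

lemma has_sum_theta:
  assumes "unit_bounded f" "0 < a" "a < 1"
  shows "((\<lambda>n. f n * a powi n\<^sup>2) has_sum theta f a) UNIV"
  unfolding theta_def using theta_summable[OF assms] by (rule has_sum_infsum)

text \<open>The geometric majorant, summed over both signs of n, is 2 a^(N^2) / (1 - a); the
  constant 4 comes from 1 - a >= 1/2.\<close>

lemma theta_approx:
  assumes "unit_bounded f" "0 < a" "a \<le> 1 / 2" "N > 0"
  shows "\<bar>theta f a - (\<Sum>n\<in>{-int N<..<int N}. f n * a powi n\<^sup>2)\<bar> \<le> 4 * a ^ N\<^sup>2"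
proof -
  let ?f = "\<lambda>n. f n * a powi n\<^sup>2"
  let ?T = "{n. int N \<le> \<bar>n\<bar>}"
  have a1: "a < 1" using assms by simp
  have sT: "?f summable_on ?T"
    using theta_summable[OF assms(1,2) a1] summable_on_subset_banach by blast
  have "UNIV = {-int N<..<int N} \<union> ?T"
    by auto
  moreover have "infsum ?f ({-int N<..<int N} \<union> ?T) = infsum ?f {-int N<..<int N} + infsum ?f ?T"
    by (rule infsum_Un_disjoint) (auto intro: sT)
  ultimately have eq: "theta f a - (\<Sum>n\<in>{-int N<..<int N}. ?f n) = infsum ?f ?T"
    unfolding theta_def by simp
  have tail: "((\<lambda>n::int. a ^ (N\<^sup>2 - N) * a ^ nat \<bar>n\<bar>) has_sum (a ^ (N\<^sup>2 - N) * (2 * a ^ N / (1 - a)))) ?T"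
    by (intro has_sum_cmult_right has_sum_power_tail) (use assms a1 in auto)
  have "norm (infsum ?f ?T) \<le> infsum (\<lambda>n::int. a ^ (N\<^sup>2 - N) * a ^ nat \<bar>n\<bar>) ?T"
    by (rule norm_infsum_le[OF has_sum_infsum[OF sT] has_sum_infsum[OF has_sum_imp_summable[OF tail]]])
      (use theta_term_bound[OF assms(1,2) a1] assms in auto)
  also have "\<dots> = a ^ (N\<^sup>2 - N) * (2 * a ^ N / (1 - a))"
    using tail by (rule infsumI)
  also have "\<dots> = 2 * a ^ N\<^sup>2 / (1 - a)"
    using assms(4) by (simp add: power_add[symmetric] power2_eq_square)
  also have "\<dots> \<le> 4 * a ^ N\<^sup>2"
    using assms by (simp add: field_simps)
  finally show ?thesis
    unfolding eq by simp
qed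

section \<open>Dissection modulo 5\<close>

definition residue_theta :: "(int \<Rightarrow> real) \<Rightarrow> real \<Rightarrow> int \<Rightarrow> real" where
  "residue_theta c y i = theta (\<lambda>n. of_bool (n mod 5 = i) * c n) y"

text \<open>Since (m + n i)(2 - i) = (2 m + n) + (2 n - m) i, the last axiom says that the weight
  c(m) c(n) on the Gaussian integers is invariant under multiplication by 2 - i.\<close>

locale gauss_weight =
  fixes c :: "int \<Rightarrow> real"
  assumes bounded: "unit_bounded c"
    and even_weight: "c (- n) = c n"
    and mult_5: "c (5 * n) = c n"
    and gauss_invariant: "c (2 * m + n) * c (2 * n - m) = c m * c n"
begin

abbreviation "R \<equiv> residue_theta c"

lemma bounded_residue: "unit_bounded (\<lambda>n. of_bool (n mod 5 = i) * c n)"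
  using bounded by (auto simp: unit_bounded_def)

lemma has_sum_residue_theta:
  assumes "0 < y" "y < 1"
  shows "((\<lambda>n. c n * y powi n\<^sup>2) has_sum R y i) {n. n mod 5 = i}"
  using has_sum_theta[OF bounded_residue assms, of i] unfolding residue_theta_def
  by (subst has_sum_cong_neutral[where T = UNIV and g = "\<lambda>n. of_bool (n mod 5 = i) * c n * y powi n\<^sup>2"]) auto

lemma residue_theta_neg:
  assumes "0 < y" "y < 1" "0 < i" "i < 5"
  shows "R y (5 - i) = R y i"
proof -
  have "((\<lambda>n. c n * y powi n\<^sup>2) has_sum R y i) {n. n mod 5 = 5 - i}"
    by (rule has_sum_reindexI[OF has_sum_residue_theta[OF assms(1,2)], where i = uminus and j = uminus])
      (use assms in \<open>auto simp: even_weight zmod_zminus1_eq_if\<close>)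
  with has_sum_residue_theta[OF assms(1,2)] show ?thesis
    by (rule has_sum_unique)
qed

lemma residue_theta_0:
  assumes "0 < y" "y < 1"
  shows "R y 0 = theta c (y ^ 25)"
proof -
  have "((\<lambda>n. c n * (y ^ 25) powi n\<^sup>2) has_sum theta c (y ^ 25)) UNIV"
    using assms by (intro has_sum_theta bounded) (auto simp: power_less_one_iff)
  then have "((\<lambda>n. c n * y powi n\<^sup>2) has_sum theta c (y ^ 25)) {n. n mod 5 = 0}"
    by (rule has_sum_reindexI[where i = "\<lambda>n. 5 * n" and j = "\<lambda>n. n div 5"])
      (auto simp: power_int_power power2_eq_square mult_5 elim!: dvdE)
  with has_sum_residue_theta[OF assms] show ?thesis
    by (rule has_sum_unique)
qed

text \<open>Multiplication by \<open>2 - i\<close> maps \<open>\<int>[i]\<close> onto \<open>{m + n i. m + 2 n \<equiv> 0 (mod 5)}\<close> and multiplies norms by 5.\<close>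

lemma theta_square_dissection:
  assumes y: "0 < y" "y < 1"
  shows "(theta c (y ^ 5))\<^sup>2 = (R y 0)\<^sup>2 + 4 * (R y 1 * R y 2)"
proof -
  let ?f = "\<lambda>n. c n * y powi n\<^sup>2"
  let ?C = "\<lambda>i. {n::int. n mod 5 = i}"
  \<comment> \<open>The condition m + 2 n \<equiv> 0 (mod 5) means m \<equiv> 3 n, so the lattice is
    a union of five products of residue classes. Apart from \<open>R y 0\<close> squared, each of
    the four products reduces to \<open>R y 1 * R y 2\<close> by
    \<open>residue_theta_neg\<close>.\<close>
  have "((\<lambda>(m, n). ?f m * ?f n) has_sum (\<Sum>i\<in>{0..4}. R y (3 * i mod 5) * R y i))
      (\<Union>i\<in>{0..4}. ?C (3 * i mod 5) \<times> ?C i)"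
    by (intro sum_has_sum has_sum_times has_sum_residue_theta y) auto
  moreover have "{0..4::int} = {0, 1, 2, 3, 4}"
    by auto
  moreover have "(\<Union>i\<in>{0..4}. ?C (3 * i mod 5) \<times> ?C i) = {(m, n). (m + 2 * n) mod 5 = 0}"
  proof -
    have "(m + 2 * n) mod 5 = 0 \<longleftrightarrow> m mod 5 = 3 * (n mod 5) mod 5" for m n :: int
    proof -
      have "m mod 5 = 3 * (n mod 5) mod 5 \<longleftrightarrow> 5 dvd m - 3 * n"
        by (simp add: mod_simps mod_eq_dvd_iff)
      also have "m - 3 * n = m + 2 * n - 5 * n"
        by simp
      also have "5 dvd m + 2 * n - 5 * n \<longleftrightarrow> 5 dvd m + 2 * n"
        by (rule dvd_diff_left_iff) simp
      finally show ?thesis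
        unfolding dvd_eq_mod_eq_0 by (rule sym)
    qed
    moreover have "n mod 5 \<le> 4" for n :: int
      using pos_mod_bound[of 5 n] by simp
    ultimately show ?thesis
      by (simp add: set_eq_iff conj_commute)
  qed
  ultimately have "((\<lambda>(m, n). ?f m * ?f n) has_sum ((R y 0)\<^sup>2 + 4 * (R y 1 * R y 2)))
      {(m, n). (m + 2 * n) mod 5 = 0}"
    using residue_theta_neg[OF y, of 1] residue_theta_neg[OF y, of 2]
    by (simp add: power2_eq_square algebra_simps)
  then have "((\<lambda>(m, n). (c m * (y ^ 5) powi m\<^sup>2) * (c n * (y ^ 5) powi n\<^sup>2)) has_sum
      ((R y 0)\<^sup>2 + 4 * (R y 1 * R y 2))) (UNIV \<times> UNIV)"
  proof (rule has_sum_reindexI[where j = "\<lambda>(m, n). (2 * m + n, 2 * n - m)"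
        and i = "\<lambda>(m, n). ((2 * m - n) div 5, (m + 2 * n) div 5)"], goal_cases)
    case (1 b)
    obtain m n where b: "b = (m, n)" by force
    have "2 * (2 * m + n) - (2 * n - m) = m * 5" "2 * m + n + 2 * (2 * n - m) = n * 5"
      by simp_all
    then show ?case
      unfolding b prod.case by (simp only: nonzero_mult_div_cancel_right zero_neq_numeral[symmetric] not_False_eq_True)
  next
    case (2 b)
    obtain m n where b: "b = (m, n)" by force
    have "2 * m + n + 2 * (2 * n - m) = n * 5"
      by simp
    then show ?case
      unfolding b prod.case mem_Collect_eq by (simp only: mod_mult_self2_is_0)
  next
    case (3 b)
    obtain m n where b: "b = (m, n)" by force
    have "5 dvd m + 2 * n"
      using 3 unfolding b by (simp add: dvd_eq_mod_eq_0)
    then obtain k where "m + 2 * n = 5 * k" ..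
    then have m: "m = 5 * k - 2 * n" by simp
    then have "2 * m - n = (2 * k - n) * 5" "m + 2 * n = k * 5"
      by simp_all
    then have "(2 * m - n) div 5 = 2 * k - n" "(m + 2 * n) div 5 = k"
      by (simp_all only: nonzero_mult_div_cancel_right zero_neq_numeral[symmetric] not_False_eq_True)
    then show ?case
      unfolding b prod.case by (simp add: m)
  next
    case (5 a)
    obtain m n where a: "a = (m, n)" by force
    have "(2 * m + n)\<^sup>2 + (2 * n - m)\<^sup>2 = 5 * m\<^sup>2 + 5 * n\<^sup>2"
      by (simp add: power2_eq_square algebra_simps)
    then have "y powi (2 * m + n)\<^sup>2 * y powi (2 * n - m)\<^sup>2 = (y ^ 5) powi m\<^sup>2 * (y ^ 5) powi n\<^sup>2"
      using y by (simp add: power_int_power flip: power_int_add)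
    moreover have "?f (2 * m + n) * ?f (2 * n - m) =
        (c (2 * m + n) * c (2 * n - m)) * (y powi (2 * m + n)\<^sup>2 * y powi (2 * n - m)\<^sup>2)"
      by (simp add: algebra_simps)
    ultimately show ?case
      unfolding a by (simp add: gauss_invariant)
  qed simp
  moreover have "((\<lambda>(m, n). (c m * (y ^ 5) powi m\<^sup>2) * (c n * (y ^ 5) powi n\<^sup>2)) has_sum
      theta c (y ^ 5) * theta c (y ^ 5)) (UNIV \<times> UNIV)"
    using y by (intro has_sum_times has_sum_theta bounded) (auto simp: power_less_one_iff)
  ultimately show ?thesis
    using has_sum_unique by (fastforce simp: power2_eq_square)
qed

end

text \<open>The right-hand side separates k from the u's, and its u-factor is the same for every
  weight. This is what makes the constant K common to the three theta constants.\<close>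

locale theta_weight = gauss_weight +
  assumes translate: "u0 + u1 + u2 + u3 + u4 = 0 \<Longrightarrow>
      c (k + u0) * c (k + u1) * c (k + u2) * c (k + u3) * c (k + u4) =
      c k * of_bool (even u0 \<and> even u1 \<and> even u2 \<and> even u3 \<and> even u4)"

text \<open>The factor over u left after splitting off the mean of a quintuple. The K of the
  overview is 16/5 times this number.\<close>

definition isogeny_constant :: "real \<Rightarrow> real" where
  "isogeny_constant y = infsum (\<lambda>(u0, u1, u2, u3, u4).
     of_bool (even u0 \<and> even u1 \<and> even u2 \<and> even u3 \<and> even u4) *
     y powi (u0\<^sup>2 + u1\<^sup>2 + u2\<^sup>2 + u3\<^sup>2 + u4\<^sup>2))
   {(u0, u1, u2, u3, u4 :: int). u0 + u1 + u2 + u3 + u4 = 0 \<and>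
     u1 mod 5 = (u0 + 1) mod 5 \<and> u2 mod 5 = (u0 + 2) mod 5 \<and>
     u3 mod 5 = (u0 + 3) mod 5 \<and> u4 mod 5 = (u0 + 4) mod 5}"

text \<open>A quintuple with \<open>n\<^sub>j \<equiv> n\<^sub>0 + j (mod 5)\<close> has an integral mean \<open>k\<close>. With \<open>n\<^sub>j = k + u\<^sub>j\<close> the norm becomes
  \<open>5 k\<^sup>2 + \<Sum> u\<^sub>j\<^sup>2\<close>, so the sum factors, and the factor over \<open>u\<close> does not depend on the weight.\<close>

lemma (in theta_weight) residue_theta_product:
  assumes y: "0 < y" "y < 1"
  shows "5 * (R y 0 * (R y 1 * R y 2)\<^sup>2) = isogeny_constant y * theta c (y ^ 5)"
proof -
  let ?f = "\<lambda>n. c n * y powi n\<^sup>2"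
  let ?C = "\<lambda>i. {n::int. n mod 5 = i}"
  let ?D = "{(n0, n1, n2, n3, n4 :: int). n1 mod 5 = (n0 + 1) mod 5 \<and> n2 mod 5 = (n0 + 2) mod 5 \<and>
     n3 mod 5 = (n0 + 3) mod 5 \<and> n4 mod 5 = (n0 + 4) mod 5}"
  let ?U = "{(u0, u1, u2, u3, u4 :: int). u0 + u1 + u2 + u3 + u4 = 0 \<and>
     u1 mod 5 = (u0 + 1) mod 5 \<and> u2 mod 5 = (u0 + 2) mod 5 \<and>
     u3 mod 5 = (u0 + 3) mod 5 \<and> u4 mod 5 = (u0 + 4) mod 5}"
  let ?F = "\<lambda>k. c k * (y ^ 5) powi k\<^sup>2"
  let ?G = "\<lambda>(u0, u1, u2, u3, u4).
     of_bool (even u0 \<and> even u1 \<and> even u2 \<and> even u3 \<and> even u4) *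
     y powi (u0\<^sup>2 + u1\<^sup>2 + u2\<^sup>2 + u3\<^sup>2 + u4\<^sup>2)"
  let ?P = "\<lambda>(n0, n1, n2, n3, n4). ?f n0 * (?f n1 * (?f n2 * (?f n3 * ?f n4)))"
  let ?S = "\<Sum>i\<in>{0..4}. R y i * (R y ((i + 1) mod 5) * (R y ((i + 2) mod 5) *
              (R y ((i + 3) mod 5) * R y ((i + 4) mod 5))))"
  have eqP: "?P = (\<lambda>(n0, m0). ?f n0 * (case m0 of (n1, m1) \<Rightarrow> ?f n1 *
      (case m1 of (n2, m2) \<Rightarrow> ?f n2 * (case m2 of (n3, n4) \<Rightarrow> ?f n3 * ?f n4))))"
    by (auto simp: fun_eq_iff)
  have "(?P has_sum ?S)
      (\<Union>i\<in>{0..4}. ?C i \<times> ?C ((i + 1) mod 5) \<times> ?C ((i + 2) mod 5) \<times> ?C ((i + 3) mod 5) \<times> ?C ((i + 4) mod 5))"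
    unfolding eqP
  proof (intro sum_has_sum has_sum_times has_sum_residue_theta y)
    fix i i' :: int
    assume "i \<noteq> i'"
    then have "?C i \<inter> ?C i' = {}"
      by auto
    then show "(?C i \<times> ?C ((i + 1) mod 5) \<times> ?C ((i + 2) mod 5) \<times> ?C ((i + 3) mod 5) \<times> ?C ((i + 4) mod 5)) \<inter>
      (?C i' \<times> ?C ((i' + 1) mod 5) \<times> ?C ((i' + 2) mod 5) \<times> ?C ((i' + 3) mod 5) \<times> ?C ((i' + 4) mod 5)) = {}"
      by (simp only: Times_Int_Times Sigma_empty1)
  qed simp
  moreover have "(\<Union>i\<in>{0..4}. ?C i \<times> ?C ((i + 1) mod 5) \<times> ?C ((i + 2) mod 5) \<times>
      ?C ((i + 3) mod 5) \<times> ?C ((i + 4) mod 5)) = ?D"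
  proof (rule set_eqI)
    fix v :: "int \<times> int \<times> int \<times> int \<times> int"
    obtain n0 n1 n2 n3 n4 where v: "v = (n0, n1, n2, n3, n4)"
      by (cases v) force
    obtain r where r: "n0 mod 5 = r" "r \<in> {0..4}"
      using pos_mod_bound[of 5 n0] by simp
    have shift: "(n0 + j) mod 5 = (r + j) mod 5" for j
      unfolding r(1)[symmetric] by (rule mod_add_left_eq[symmetric])
    show "v \<in> (\<Union>i\<in>{0..4}. ?C i \<times> ?C ((i + 1) mod 5) \<times> ?C ((i + 2) mod 5) \<times>
        ?C ((i + 3) mod 5) \<times> ?C ((i + 4) mod 5)) \<longleftrightarrow> v \<in> ?D"
      unfolding v using r(2)
      by (simp only: UN_iff mem_Times_iff fst_conv snd_conv mem_Collect_eq prod.case r(1) shift) blast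
  qed
  ultimately have "(?P has_sum ?S) ?D"
    by simp
  moreover have "{0..4::int} = {0, 1, 2, 3, 4}"
    by auto
  then have "?S = 5 * (R y 0 * (R y 1 * R y 2)\<^sup>2)"
    using residue_theta_neg[OF y, of 1] residue_theta_neg[OF y, of 2]
    by (simp add: power2_eq_square algebra_simps)
  ultimately have "(?P has_sum (5 * (R y 0 * (R y 1 * R y 2)\<^sup>2))) ?D"
    by simp
  then have *: "((\<lambda>(k, u). ?F k * ?G u) has_sum (5 * (R y 0 * (R y 1 * R y 2)\<^sup>2))) (UNIV \<times> ?U)"
  proof (rule has_sum_reindexI[where j = "\<lambda>(k, u0, u1, u2, u3, u4). (k + u0, k + u1, k + u2, k + u3, k + u4)"
        and i = "\<lambda>(n0, n1, n2, n3, n4). let k = (n0 + n1 + n2 + n3 + n4) div 5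
          in (k, n0 - k, n1 - k, n2 - k, n3 - k, n4 - k)"], goal_cases)
    case (1 a)
    obtain k u0 u1 u2 u3 u4 where a: "a = (k, u0, u1, u2, u3, u4)"
      by (cases a) force
    have "(k + u0) + (k + u1) + (k + u2) + (k + u3) + (k + u4) = k * 5"
      using 1 unfolding a by simp
    then have "((k + u0) + (k + u1) + (k + u2) + (k + u3) + (k + u4)) div 5 = k"
      by simp
    then show ?case
      unfolding a by (simp add: Let_def)
  next
    case (2 a)
    obtain k u0 u1 u2 u3 u4 where a: "a = (k, u0, u1, u2, u3, u4)"
      by (cases a) force
    have "(k + m) mod 5 = (k + u0 + j) mod 5" if "m mod 5 = (u0 + j) mod 5" for m j
      using that by (metis add.assoc mod_add_right_eq)
    then show ?case
      using 2 unfolding a by simp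
  next
    case (3 b)
    then show ?case
      by (simp add: case_prod_unfold Let_def)
  next
    case (4 b)
    obtain n0 n1 n2 n3 n4 where b: "b = (n0, n1, n2, n3, n4)"
      by (cases b) force
    have ex: "\<exists>q. m = n0 + j + 5 * q" if "m mod 5 = (n0 + j) mod 5" for m j
      using that by (metis add.commute mod_eqE)
    from 4 have m: "n1 mod 5 = (n0 + 1) mod 5" "n2 mod 5 = (n0 + 2) mod 5"
        "n3 mod 5 = (n0 + 3) mod 5" "n4 mod 5 = (n0 + 4) mod 5"
      unfolding b by simp_all
    obtain q1 q2 q3 q4 where
      "n1 = n0 + 1 + 5 * q1" "n2 = n0 + 2 + 5 * q2" "n3 = n0 + 3 + 5 * q3" "n4 = n0 + 4 + 5 * q4"
      using m[THEN ex] by blast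
    note n = this
    \<comment> \<open>The mean of the quintuple: the offsets 1 + 2 + 3 + 4 = 10 contribute 2 after
      division by 5.\<close>
    define k where "k = n0 + 2 + q1 + q2 + q3 + q4"
    have "n0 + n1 + n2 + n3 + n4 = k * 5"
      unfolding n k_def by simp
    then have d: "(n0 + n1 + n2 + n3 + n4) div 5 = k"
      by simp
    have "(n0 + j + 5 * q - k) mod 5 = (n0 - k + j) mod 5" for j q
    proof -
      have "n0 + j + 5 * q - k = n0 - k + j + 5 * q"
        by simp
      then show ?thesis
        by (simp only: mod_mult_self2)
    qed
    then have "(n1 - k) mod 5 = (n0 - k + 1) mod 5" "(n2 - k) mod 5 = (n0 - k + 2) mod 5"
        "(n3 - k) mod 5 = (n0 - k + 3) mod 5" "(n4 - k) mod 5 = (n0 - k + 4) mod 5"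
      unfolding n by blast+
    moreover have "(n0 - k) + (n1 - k) + (n2 - k) + (n3 - k) + (n4 - k) = 0"
      unfolding n k_def by simp
    ultimately show ?case
      unfolding b Let_def prod.case d by blast
  next
    case (5 a)
    obtain k u0 u1 u2 u3 u4 where a: "a = (k, u0, u1, u2, u3, u4)"
      by (cases a) force
    have u: "u0 + u1 + u2 + u3 + u4 = 0"
      using 5 unfolding a by simp
    have "(k + u0)\<^sup>2 + (k + u1)\<^sup>2 + (k + u2)\<^sup>2 + (k + u3)\<^sup>2 + (k + u4)\<^sup>2 =
        5 * k\<^sup>2 + 2 * k * (u0 + u1 + u2 + u3 + u4) + (u0\<^sup>2 + u1\<^sup>2 + u2\<^sup>2 + u3\<^sup>2 + u4\<^sup>2)"
      by (simp add: power2_eq_square algebra_simps)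
    then have "(k + u0)\<^sup>2 + (k + u1)\<^sup>2 + (k + u2)\<^sup>2 + (k + u3)\<^sup>2 + (k + u4)\<^sup>2 =
        5 * k\<^sup>2 + (u0\<^sup>2 + u1\<^sup>2 + u2\<^sup>2 + u3\<^sup>2 + u4\<^sup>2)"
      unfolding u by simp
    then have "y powi (k + u0)\<^sup>2 * y powi (k + u1)\<^sup>2 * y powi (k + u2)\<^sup>2 * y powi (k + u3)\<^sup>2 * y powi (k + u4)\<^sup>2 =
        (y ^ 5) powi k\<^sup>2 * y powi (u0\<^sup>2 + u1\<^sup>2 + u2\<^sup>2 + u3\<^sup>2 + u4\<^sup>2)"
      using y by (simp add: power_int_power flip: power_int_add)
    moreover have "?f (k + u0) * (?f (k + u1) * (?f (k + u2) * (?f (k + u3) * ?f (k + u4)))) =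
      (c (k + u0) * c (k + u1) * c (k + u2) * c (k + u3) * c (k + u4)) *
      (y powi (k + u0)\<^sup>2 * y powi (k + u1)\<^sup>2 * y powi (k + u2)\<^sup>2 * y powi (k + u3)\<^sup>2 * y powi (k + u4)\<^sup>2)"
      by simp
    ultimately show ?case
      unfolding a using translate[OF u, of k] by simp
  qed
  \<comment> \<open>Only the double sum is known to converge. The primed rules for constant factors
    hold for \<open>infsum\<close> in any case, so the series defining
    \<open>isogeny_constant\<close> needs no convergence proof of its own.\<close>
  have "infsum (\<lambda>k. infsum (\<lambda>u. ?F k * ?G u) ?U) UNIV = 5 * (R y 0 * (R y 1 * R y 2)\<^sup>2)"
    using infsum_Sigma'_banach[OF has_sum_imp_summable[OF *]] infsumI[OF *] by simp
  moreover have "infsum (\<lambda>u. ?F k * ?G u) ?U = ?F k * isogeny_constant y" for k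
    unfolding isogeny_constant_def by (rule infsum_cmult_right')
  moreover have "infsum (\<lambda>k. ?F k * isogeny_constant y) UNIV = theta c (y ^ 5) * isogeny_constant y"
    unfolding theta_def by (rule infsum_cmult_left')
  ultimately show ?thesis
    by (simp add: mult.commute)
qed

section \<open>The quintic modular equation\<close>

text \<open>If \<open>(t\<^sup>2 - s\<^sup>2)\<^sup>2 s = K t\<close> and \<open>r = t / s\<close>, then \<open>s^4 = K quintic_low r\<close> and
  \<open>t^4 = K quintic_high r\<close>.\<close>

definition quintic_low :: "real \<Rightarrow> real" where
  "quintic_low r = r / (r\<^sup>2 - 1)\<^sup>2"

definition quintic_high :: "real \<Rightarrow> real" where
  "quintic_high r = r ^ 5 / (r\<^sup>2 - 1)\<^sup>2"

section \<open>Monotonicity of \<open>quintic_low\<close> and \<open>quintic_high\<close>\<close>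

lemma quintic_low_less_below_1:
  assumes "0 < x" "x < y" "y < 1"
  shows "quintic_low x < quintic_low y"
proof -
  have "y\<^sup>2 < 1" "x\<^sup>2 < y\<^sup>2"
    using assms by (simp_all add: power_less_one_iff power_strict_mono)
  then have "0 < 1 - y\<^sup>2" "1 - y\<^sup>2 < 1 - x\<^sup>2"
    by simp_all
  then have "(1 - y\<^sup>2)\<^sup>2 < (1 - x\<^sup>2)\<^sup>2" "0 < (1 - y\<^sup>2)\<^sup>2"
    by (auto intro: power_strict_mono)
  then show ?thesis
    unfolding quintic_low_def power2_commute[of _ 1] using assms by (intro frac_less) auto
qed

lemma quintic_high_less_below_1:
  assumes "0 < x" "x < y" "y < 1"
  shows "quintic_high x < quintic_high y"
proof -
  have "quintic_high r = r ^ 4 * quintic_low r" for r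
    by (simp add: quintic_high_def quintic_low_def eval_nat_numeral)
  moreover have "0 \<le> quintic_low x"
    using assms by (simp add: quintic_low_def)
  moreover have "x ^ 4 < y ^ 4"
    using assms by (intro power_strict_mono) auto
  ultimately show ?thesis
    using quintic_low_less_below_1[OF assms] assms by (simp add: mult_strict_mono)
qed

text \<open>Dividing numerator and denominator by r^4 gives r^(-3) / (1 - r^(-2))^2, where the
  numerator decreases and the denominator increases with r.\<close>

lemma quintic_low_less_above_1:
  assumes "1 < x" "x < y"
  shows "quintic_low y < quintic_low x"
proof -
  have eq: "quintic_low r = (1 / r ^ 3) / (1 - (1 / r)\<^sup>2)\<^sup>2" if "1 < r" for r
    using that by (simp add: quintic_low_def field_simps eval_nat_numeral)
  have "1 / y < 1 / x" "1 / x < 1"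
    using assms by (auto simp: field_simps)
  then have "(1 / y)\<^sup>2 < (1 / x)\<^sup>2" "(1 / x)\<^sup>2 < 1"
    using assms power_strict_mono[of "1 / y" "1 / x" 2] power_strict_mono[of "1 / x" 1 2] by auto
  then have den: "(1 - (1 / x)\<^sup>2)\<^sup>2 \<le> (1 - (1 / y)\<^sup>2)\<^sup>2" "0 < (1 - (1 / x)\<^sup>2)\<^sup>2"
    by (auto intro!: power_mono)
  have num: "0 \<le> 1 / y ^ 3" "1 / y ^ 3 < 1 / x ^ 3"
    using assms by (simp_all add: field_simps power_strict_mono)
  have "(1 / y ^ 3) / (1 - (1 / y)\<^sup>2)\<^sup>2 < (1 / x ^ 3) / (1 - (1 / x)\<^sup>2)\<^sup>2"
    by (rule frac_less[OF num den(2,1)])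
  with eq show ?thesis
    using assms by simp
qed

text \<open>With r = p^2 the function is the square of p^5 / (p^4 - 1). Cross-multiplying for p < q
  leaves the factor q - p times p^4 q^4 - (q^4 + q^3 p + q^2 p^2 + q p^3 + p^4), which is positive
  as soon as p^4 > 5; here p^4 > 9.\<close>

lemma quintic_high_less_above_3:
  assumes "3 < x" "x < y"
  shows "quintic_high x < quintic_high y"
proof -
  define p q where "p = sqrt x" and "q = sqrt y"
  have xy: "x = p\<^sup>2" "y = q\<^sup>2" and pq: "0 < p" "p < q"
    using assms by (auto simp: p_def q_def)
  have "9 < x * x"
    using assms mult_strict_mono[of 3 x 3 x] by simp
  then have p4: "9 < p ^ 4"
    by (simp add: xy eval_nat_numeral)
  have le: "p \<le> q" "0 \<le> p" "0 \<le> q" using pq by auto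
  have "q ^ 3 * p \<le> q ^ 3 * q" "q\<^sup>2 * p\<^sup>2 \<le> q\<^sup>2 * q\<^sup>2" "q * p ^ 3 \<le> q * q ^ 3" "p ^ 4 \<le> q ^ 4"
    using le by (intro mult_left_mono power_mono; simp)+
  then have "q ^ 4 + q ^ 3 * p + q\<^sup>2 * p\<^sup>2 + q * p ^ 3 + p ^ 4 \<le> 5 * q ^ 4"
    by (simp add: eval_nat_numeral)
  also have "\<dots> < p ^ 4 * q ^ 4"
    using p4 pq by (intro mult_strict_right_mono) auto
  finally have "0 < (q - p) * (p ^ 4 * q ^ 4 - (q ^ 4 + q ^ 3 * p + q\<^sup>2 * p\<^sup>2 + q * p ^ 3 + p ^ 4))"
    using pq by simp
  also have "\<dots> = q ^ 5 * (p ^ 4 - 1) - p ^ 5 * (q ^ 4 - 1)"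
    by (simp add: algebra_simps eval_nat_numeral)
  finally have "p ^ 5 * (q ^ 4 - 1) < q ^ 5 * (p ^ 4 - 1)"
    by simp
  moreover have "p ^ 4 < q ^ 4"
    using pq by (intro power_strict_mono) auto
  then have q4: "9 < q ^ 4" using p4 by simp
  ultimately have "(p ^ 5 * (q ^ 4 - 1))\<^sup>2 < (q ^ 5 * (p ^ 4 - 1))\<^sup>2"
    using pq by (intro power_strict_mono) auto
  then have "x ^ 5 * (y\<^sup>2 - 1)\<^sup>2 < y ^ 5 * (x\<^sup>2 - 1)\<^sup>2"
    unfolding xy by (simp add: power_mult_distrib flip: power_mult)
  moreover have "1 < x\<^sup>2" "1 < y\<^sup>2"
    unfolding xy using p4 q4 by (simp_all flip: power_mult)
  ultimately show ?thesis
    by (simp add: quintic_high_def frac_less_eq divide_less_eq field_simps)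
qed

text \<open>The explicit solution of the two ratio equations, given by its elementary symmetric
  functions: with P = 1 + a b one has a + b = r P and P = 4 / (r^2 - 1). Everything follows from
  (a^2 - 1)(b^2 - 1) = (1 + a b)^2 - (a + b)^2 = -4 P. The third conclusion is the relation that the
  theta identity needs.\<close>

lemma quintic_param:
  fixes a b r :: real
  assumes sum: "a + b = r * (1 + a * b)" and prod: "(r\<^sup>2 - 1) * (1 + a * b) = 4"
  shows "quintic_low a + quintic_low b = quintic_low r"
    and "quintic_high a + quintic_high b = quintic_high r"
    and "a / (a\<^sup>2 - 1) + b / (b\<^sup>2 - 1) = r / 2 - r / (r\<^sup>2 - 1)"
proof -
  define P where "P = 1 + a * b"
  define X where "X = r\<^sup>2 - 1"
  have XP: "X * P = 4" using prod by (simp add: P_def X_def)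
  then have nz: "X \<noteq> 0" "P \<noteq> 0" by auto
  have ab: "a * b = P - 1" by (simp add: P_def)
  have s: "a + b = r * P" using sum by (simp add: P_def)
  have r2: "r\<^sup>2 * P = P + 4"
    using XP by (simp add: X_def algebra_simps)
  have "(a\<^sup>2 - 1) * (b\<^sup>2 - 1) = (a * b + 1)\<^sup>2 - (a + b)\<^sup>2"
    by (simp add: power2_eq_square algebra_simps)
  also have "\<dots> = P\<^sup>2 - (r\<^sup>2 * P) * P"
    unfolding ab s by (simp add: power2_eq_square algebra_simps)
  also have "\<dots> = - 4 * P"
    unfolding r2 by (simp add: power2_eq_square algebra_simps)
  finally have AB: "(a\<^sup>2 - 1) * (b\<^sup>2 - 1) = - 4 * P" .
  with nz have ab_nz: "a\<^sup>2 - 1 \<noteq> 0" "b\<^sup>2 - 1 \<noteq> 0"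
    by auto
  have XP': "1 / X = P / 4" "X = 4 / P"
    using XP nz by (auto simp: field_simps)
  have "a * (b\<^sup>2 - 1) + b * (a\<^sup>2 - 1) = (a + b) * (a * b - 1)"
    by (simp add: power2_eq_square algebra_simps)
  then have "a * (b\<^sup>2 - 1) + b * (a\<^sup>2 - 1) = r * P * (P - 2)"
    unfolding ab s by simp
  moreover have "a / (a\<^sup>2 - 1) + b / (b\<^sup>2 - 1) =
      (a * (b\<^sup>2 - 1) + b * (a\<^sup>2 - 1)) / ((a\<^sup>2 - 1) * (b\<^sup>2 - 1))"
    using ab_nz by (simp add: add_frac_eq)
  ultimately have "a / (a\<^sup>2 - 1) + b / (b\<^sup>2 - 1) = r * P * (P - 2) / (- 4 * P)"
    unfolding AB by simp
  also have "\<dots> = r / 2 - r * (1 / X)"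
    unfolding XP' using nz by (simp add: field_simps)
  finally show "a / (a\<^sup>2 - 1) + b / (b\<^sup>2 - 1) = r / 2 - r / (r\<^sup>2 - 1)"
    by (simp add: X_def)
  have den: "(a\<^sup>2 - 1)\<^sup>2 * (b\<^sup>2 - 1)\<^sup>2 = 16 * P\<^sup>2"
    using AB by (simp add: power_mult_distrib flip: power_mult_distrib[of "a\<^sup>2 - 1"])
  have s2: "(a + b)\<^sup>2 = P\<^sup>2 + 4 * P"
  proof -
    have "(a + b)\<^sup>2 = (r\<^sup>2 * P) * P" unfolding s by (simp add: power2_eq_square)
    then show ?thesis unfolding r2 by (simp add: power2_eq_square algebra_simps)
  qed
  have "a * (b\<^sup>2 - 1)\<^sup>2 + b * (a\<^sup>2 - 1)\<^sup>2 =
      (a + b) * ((a * b) * ((a + b)\<^sup>2 - 3 * (a * b)) - 2 * (a * b) + 1)"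
    by (simp add: power2_eq_square algebra_simps)
  also have "\<dots> = r * P * P ^ 3"
    unfolding s2 unfolding ab s by (simp add: eval_nat_numeral algebra_simps)
  finally have n1: "a * (b\<^sup>2 - 1)\<^sup>2 + b * (a\<^sup>2 - 1)\<^sup>2 = r * P ^ 4"
    by (simp add: eval_nat_numeral)
  have "quintic_low a + quintic_low b =
      (a * (b\<^sup>2 - 1)\<^sup>2 + b * (a\<^sup>2 - 1)\<^sup>2) / ((a\<^sup>2 - 1)\<^sup>2 * (b\<^sup>2 - 1)\<^sup>2)"
    unfolding quintic_low_def using ab_nz by (simp add: add_frac_eq)
  also have "\<dots> = r * (1 / X)\<^sup>2"
    unfolding den n1 XP' using nz by (simp add: field_simps eval_nat_numeral)
  finally show low: "quintic_low a + quintic_low b = quintic_low r"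
    by (simp add: quintic_low_def X_def power_divide)
  \<comment> \<open>As x^5 - x = x (x^2 - 1)(x^2 + 1), the difference loses one factor of its
    denominator. The second claim thereby reduces to the first and the third.\<close>
  have high_low: "quintic_high x - quintic_low x = x + 2 * (x / (x\<^sup>2 - 1))" if "x\<^sup>2 - 1 \<noteq> 0" for x
  proof -
    have "quintic_high x - quintic_low x = x * (x\<^sup>2 - 1) * (x\<^sup>2 + 1) / (x\<^sup>2 - 1)\<^sup>2"
      by (simp add: quintic_high_def quintic_low_def eval_nat_numeral algebra_simps flip: diff_divide_distrib)
    also have "\<dots> = x * (x\<^sup>2 + 1) / (x\<^sup>2 - 1)"
      using that by (simp add: power2_eq_square)
    also have "\<dots> = x + 2 * (x / (x\<^sup>2 - 1))"
      using that by (simp add: field_simps)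
    finally show ?thesis .
  qed
  have "(quintic_high a - quintic_low a) + (quintic_high b - quintic_low b) = quintic_high r - quintic_low r"
  proof -
    have "(a + b) + 2 * (a / (a\<^sup>2 - 1) + b / (b\<^sup>2 - 1)) = r + 2 * (r / (r\<^sup>2 - 1))"
    proof -
      have "r / (r\<^sup>2 - 1) = r * (1 / X)" by (simp add: X_def)
      then show ?thesis
        unfolding \<open>a / (a\<^sup>2 - 1) + b / (b\<^sup>2 - 1) = r / 2 - r / (r\<^sup>2 - 1)\<close> s XP'(1)
        by (simp add: algebra_simps)
    qed
    then show ?thesis
      using high_low[OF ab_nz(1)] high_low[OF ab_nz(2)] high_low[of r] nz by (simp add: X_def)
  qed
  with low show "quintic_high a + quintic_high b = quintic_high r"
    by simp
qed

text \<open>If a < a', then \<open>quintic_low\<close> drops from a to a', so the first equation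
  forces b < b'. But then both summands of the \<open>quintic_high\<close> equation grow
  strictly.\<close>

lemma quintic_unique:
  assumes low: "quintic_low a + quintic_low b = quintic_low a' + quintic_low b'"
    and high: "quintic_high a + quintic_high b = quintic_high a' + quintic_high b'"
    and a: "3 < a" "3 < a'" and b: "0 < b" "b < 1" "0 < b'" "b' < 1"
  shows "a = a'" "b = b'"
proof -
  have impossible: False
    if "quintic_low a + quintic_low b = quintic_low a' + quintic_low b'"
      "quintic_high a + quintic_high b = quintic_high a' + quintic_high b'"
      "3 < a" "a < a'" "0 < b" "b < 1" "0 < b'" "b' < 1" for a b a' b'
  proof -
    have "quintic_low b < quintic_low b'"
      using quintic_low_less_above_1[of a a'] that by auto
    then have "b < b'"
      using quintic_low_less_below_1[of b' b] that by (cases b b' rule: linorder_cases) auto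
    then show False
      using quintic_high_less_below_1[of b b'] quintic_high_less_above_3[of a a'] that by auto
  qed
  show "a = a'"
    using impossible[of a b a' b'] impossible[of a' b' a b] assms by (cases a a' rule: linorder_cases) auto
  with low have "quintic_low b = quintic_low b'"
    by simp
  then show "b = b'"
    using quintic_low_less_below_1[of b b'] quintic_low_less_below_1[of b' b] b
    by (cases b b' rule: linorder_cases) auto
qed

text \<open>By uniqueness (a, b) must be the explicit solution of \<open>quintic_param\<close>. The
  bound r^2 < 3/2 places that solution in the region a > 3, 0 < b < 1 where uniqueness
  holds.\<close>

lemma quintic_modular_equation:
  assumes low: "quintic_low a + quintic_low b = quintic_low r"
    and high: "quintic_high a + quintic_high b = quintic_high r"
    and a: "3 < a" and b: "0 < b" "b < 1" and r: "1 < r" "r\<^sup>2 < 3 / 2"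
  shows "a / (a\<^sup>2 - 1) + b / (b\<^sup>2 - 1) = r / 2 - r / (r\<^sup>2 - 1)"
proof -
  define X where "X = r\<^sup>2 - 1"
  define d where "d = sqrt (X\<^sup>2 + 4)"
  \<comment> \<open>The roots of T^2 - (4 r / X) T + (4 - X) / X, the polynomial with the sum and
    the product prescribed in \<open>quintic_param\<close>; a quarter of its discriminant is (X^2 +
    4) / X^2.\<close>
  define a' b' where "a' = (2 * r + d) / X" and "b' = (2 * r - d) / X"
  have X: "0 < X" "X < 1 / 2"
    using r by (auto simp: X_def one_less_power)
  have d2: "d\<^sup>2 = X\<^sup>2 + 4"
    by (simp add: d_def)
  have "sqrt (2\<^sup>2) \<le> d"
    unfolding d_def by (intro real_sqrt_le_mono) simp
  then have d: "2 \<le> d" by simp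
  have r2: "r\<^sup>2 = X + 1" by (simp add: X_def)
  have "a' * b' = ((2 * r)\<^sup>2 - d\<^sup>2) / X\<^sup>2"
    by (simp add: a'_def b'_def power2_eq_square algebra_simps)
  also have "\<dots> = (4 - X) / X"
    unfolding d2 power_mult_distrib r2 using X by (simp add: field_simps power2_eq_square)
  finally have ab: "1 + a' * b' = 4 / X"
    using X by (simp add: field_simps)
  have sum: "a' + b' = r * (1 + a' * b')"
    unfolding ab by (simp add: a'_def b'_def flip: add_divide_distrib)
  have prod: "(r\<^sup>2 - 1) * (1 + a' * b') = 4"
    unfolding ab X_def[symmetric] using X by simp
  have "3 * X < 2 * r + d"
    using X r d by linarith
  then have a': "3 < a'"
    using X by (simp add: a'_def field_simps)
  \<comment> \<open>Rationalising replaces the difference 2 r - d by a quotient with visible sign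
    and size: 2 r + d > 4 gives 0 < b' < 1.\<close>
  have "b' = ((2 * r - d) * (2 * r + d)) / (X * (2 * r + d))"
    using r d by (simp add: b'_def)
  also have "(2 * r - d) * (2 * r + d) = (2 * r)\<^sup>2 - d\<^sup>2"
    by (simp add: power2_eq_square algebra_simps)
  also have "((2 * r)\<^sup>2 - d\<^sup>2) / (X * (2 * r + d)) = (X * (4 - X)) / (X * (2 * r + d))"
    unfolding d2 power_mult_distrib r2 by (simp add: algebra_simps power2_eq_square)
  also have "\<dots> = (4 - X) / (2 * r + d)"
    using X by simp
  finally have b'_eq: "b' = (4 - X) / (2 * r + d)" .
  have b': "0 < b'" "b' < 1"
    unfolding b'_eq using X r d by (auto simp: field_simps)
  have "a = a'" "b = b'"
    using quintic_unique[of a b a' b'] quintic_param(1,2)[OF sum prod] low high a a' b b' by auto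
  then show ?thesis
    using quintic_param(3)[OF sum prod] by simp
qed

text \<open>Here ti and si stand for the theta constants at q and q^5, while \<alpha> and \<beta>
  are the products at other powers of q, known through their squares and their sign. After passing
  to the ratios ti / si the claim becomes the linear relation of
  \<open>quintic_modular_equation\<close>.\<close>

lemma theta_quintic_algebra:
  fixes K \<alpha> \<beta> t2 t3 t4 s2 s3 s4 :: real
  assumes K: "K \<noteq> 0"
    and pos: "0 < t2" "0 < t3" "0 < t4" "0 < s2" "0 < s3" "0 < s4" "0 \<le> \<alpha>" "0 \<le> \<beta>"
    and r: "3 * s2 < t2" "t4 < s4" "s3 < t3" "t3\<^sup>2 < 3 / 2 * s3\<^sup>2"
    and q2: "(t2\<^sup>2 - s2\<^sup>2)\<^sup>2 * s2 = K * t2"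
    and q3: "(t3\<^sup>2 - s3\<^sup>2)\<^sup>2 * s3 = K * t3"
    and q4: "(t4\<^sup>2 - s4\<^sup>2)\<^sup>2 * s4 = K * t4"
    and jt: "t2 ^ 4 + t4 ^ 4 = t3 ^ 4" and js: "s2 ^ 4 + s4 ^ 4 = s3 ^ 4"
    and \<alpha>: "\<alpha>\<^sup>2 = 4 * (t2 * t3) * (s2 * s3)" and \<beta>: "\<beta>\<^sup>2 = (t3 * t4) * (s3 * s4)"
  shows "t3 ^ 3 - 3 * t3 * s3\<^sup>2 = \<alpha> * s2 - 2 * \<beta> * s4"
proof -
  define r2 r3 r4 where "r2 = t2 / s2" and "r3 = t3 / s3" and "r4 = t4 / s4"
  have t: "t2 = r2 * s2" "t3 = r3 * s3" "t4 = r4 * s4"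
    using pos by (auto simp: r2_def r3_def r4_def)
  have bounds: "3 < r2" "0 < r4" "r4 < 1" "1 < r3"
    using pos r by (auto simp: r2_def r3_def r4_def field_simps)
  have r3_less: "r3\<^sup>2 < 3 / 2"
    using r(4) pos unfolding t by (simp add: power_mult_distrib)
  have s_pow: "s ^ 4 = K * quintic_low \<rho>" and t_pow: "(\<rho> * s) ^ 4 = K * quintic_high \<rho>"
    if "((\<rho> * s)\<^sup>2 - s\<^sup>2)\<^sup>2 * s = K * (\<rho> * s)" "0 < s" "\<rho>\<^sup>2 \<noteq> 1" for s \<rho>
  proof -
    have "s ^ 4 * (\<rho>\<^sup>2 - 1)\<^sup>2 * s = K * \<rho> * s"
      using that(1) by (simp add: eval_nat_numeral algebra_simps)
    then have "s ^ 4 * (\<rho>\<^sup>2 - 1)\<^sup>2 = K * \<rho>"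
      using that(2) by simp
    then show "s ^ 4 = K * quintic_low \<rho>"
      using that(3) by (simp add: quintic_low_def field_simps)
    then have "\<rho> ^ 4 * s ^ 4 = K * (\<rho> ^ 4 * quintic_low \<rho>)"
      by simp
    moreover have "\<rho> ^ 4 * quintic_low \<rho> = quintic_high \<rho>"
      by (simp add: quintic_low_def quintic_high_def eval_nat_numeral)
    ultimately show "(\<rho> * s) ^ 4 = K * quintic_high \<rho>"
      by (simp add: power_mult_distrib)
  qed
  have ne: "r2\<^sup>2 \<noteq> 1" "r3\<^sup>2 \<noteq> 1" "r4\<^sup>2 \<noteq> 1"
    using bounds by (auto simp: power2_eq_1_iff)
  note s_pows = s_pow[OF q2[unfolded t] pos(4) ne(1)] s_pow[OF q3[unfolded t] pos(5) ne(2)]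
    s_pow[OF q4[unfolded t] pos(6) ne(3)]
  note t_pows = t_pow[OF q2[unfolded t] pos(4) ne(1)] t_pow[OF q3[unfolded t] pos(5) ne(2)]
    t_pow[OF q4[unfolded t] pos(6) ne(3)]
  have "K * (quintic_low r2 + quintic_low r4) = K * quintic_low r3"
    using js by (simp add: s_pows algebra_simps)
  then have low: "quintic_low r2 + quintic_low r4 = quintic_low r3"
    using K by simp
  have "K * (quintic_high r2 + quintic_high r4) = K * quintic_high r3"
    using jt unfolding t t_pows by (simp add: algebra_simps)
  then have high: "quintic_high r2 + quintic_high r4 = quintic_high r3"
    using K by simp
  have main: "r2 / (r2\<^sup>2 - 1) + r4 / (r4\<^sup>2 - 1) = r3 / 2 - r3 / (r3\<^sup>2 - 1)"
    by (rule quintic_modular_equation) fact+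
  define X where "X = r3\<^sup>2 - 1"
  have X: "0 < X" using bounds by (simp add: X_def)
  \<comment> \<open>Eliminating K through s3^4 = K \<open>quintic_low\<close> r3 makes the square of
    \<gamma> s a perfect square in \<rho>, r3 and s3; the root is determined up to sign.\<close>
  have root: "\<gamma> * s = r3 * s3 ^ 3 * \<bar>\<rho> * X / (r3 * (\<rho>\<^sup>2 - 1))\<bar>"
    if "\<gamma>\<^sup>2 = \<rho> * s\<^sup>2 * (r3 * s3\<^sup>2)" "s ^ 4 = K * quintic_low \<rho>" "0 \<le> \<gamma>" "0 < s" "0 < \<rho>" "\<rho>\<^sup>2 \<noteq> 1" for \<gamma> s \<rho>
  proof -
    have "(\<gamma> * s)\<^sup>2 = \<rho> * r3 * s3\<^sup>2 * s ^ 4"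
      unfolding power_mult_distrib that(1) by (simp add: eval_nat_numeral)
    also have "\<dots> = s3\<^sup>2 * (K * quintic_low r3) * (\<rho> * X)\<^sup>2 / (\<rho>\<^sup>2 - 1)\<^sup>2"
      unfolding that(2) quintic_low_def X_def using ne by (simp add: power2_eq_square)
    also have "\<dots> = (r3 * s3 ^ 3 * (\<rho> * X / (r3 * (\<rho>\<^sup>2 - 1))))\<^sup>2"
      unfolding s_pows(2)[symmetric] using bounds by (simp add: power_mult_distrib power_divide eval_nat_numeral)
    finally have "\<bar>\<gamma> * s\<bar> = \<bar>r3 * s3 ^ 3 * (\<rho> * X / (r3 * (\<rho>\<^sup>2 - 1)))\<bar>"
      by (simp add: power2_eq_iff abs_eq_iff)
    then show ?thesis
      using that bounds pos by (simp add: abs_mult)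
  qed
  have "1 < r2\<^sup>2" "r4\<^sup>2 < 1"
    using bounds by (simp_all add: one_less_power power_less_one_iff)
  \<comment> \<open>Since r2 > 1 > r4, the two roots are taken with opposite signs. This turns the
    difference \<alpha> s2 - 2 \<beta> s4 into a multiple of the sum in \<open>main\<close>.\<close>
  then have sgn: "0 < r2 * X / (r3 * (r2\<^sup>2 - 1))" "r4 * X / (r3 * (r4\<^sup>2 - 1)) < 0"
    using bounds X by (simp_all add: divide_pos_neg mult_pos_neg)
  have \<gamma>: "(\<alpha> / 2)\<^sup>2 = r2 * s2\<^sup>2 * (r3 * s3\<^sup>2)" "\<beta>\<^sup>2 = r4 * s4\<^sup>2 * (r3 * s3\<^sup>2)"
    using \<alpha> \<beta> by (simp_all add: t power_divide power2_eq_square)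
  have "\<alpha> / 2 * s2 = r3 * s3 ^ 3 * \<bar>r2 * X / (r3 * (r2\<^sup>2 - 1))\<bar>"
    by (rule root[OF \<gamma>(1) s_pows(1)]) (use pos bounds ne in auto)
  moreover have "\<beta> * s4 = r3 * s3 ^ 3 * \<bar>r4 * X / (r3 * (r4\<^sup>2 - 1))\<bar>"
    by (rule root[OF \<gamma>(2) s_pows(3)]) (use pos bounds ne in auto)
  moreover have "r3 * s3 ^ 3 * (\<rho> * X / (r3 * D)) = s3 ^ 3 * X * (\<rho> / D)" for \<rho> D
    using bounds by simp
  ultimately have "\<alpha> / 2 * s2 = s3 ^ 3 * X * (r2 / (r2\<^sup>2 - 1))"
    "\<beta> * s4 = - (s3 ^ 3 * X * (r4 / (r4\<^sup>2 - 1)))"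
    unfolding abs_of_pos[OF sgn(1)] abs_of_neg[OF sgn(2)] mult_minus_right by metis+
  then have "\<alpha> * s2 - 2 * \<beta> * s4 =
      2 * s3 ^ 3 * X * (r2 / (r2\<^sup>2 - 1) + r4 / (r4\<^sup>2 - 1))"
    unfolding distrib_left by linarith
  also have "\<dots> = s3 ^ 3 * (r3 * X - 2 * r3)"
    unfolding main X_def[symmetric] using X by (simp add: field_simps)
  also have "\<dots> = t3 ^ 3 - 3 * t3 * s3\<^sup>2"
    unfolding t X_def by (simp add: eval_nat_numeral algebra_simps)
  finally show ?thesis by simp
qed

section \<open>Theta constants\<close>

definition parity_sign :: "int \<Rightarrow> real" where
  "parity_sign n = (if even n then 1 else - 1)"

definition odd_weight :: "int \<Rightarrow> real" where
  "odd_weight n = of_bool (odd n)"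

definition even_weight :: "int \<Rightarrow> real" where
  "even_weight n = of_bool (even n)"

definition alt_weight :: "int \<Rightarrow> real" where
  "alt_weight n = (if even n then parity_sign (n div 2) else 0)"

text \<open>The nonprincipal Dirichlet character modulo 4. It separates the odd residue classes
  modulo 4, and its theta series vanishes because it is an odd function.\<close>

definition chi4 :: "int \<Rightarrow> real" where
  "chi4 n = (if odd n then parity_sign ((n - 1) div 2) else 0)"

lemma parity_sign_add: "parity_sign (m + n) = parity_sign m * parity_sign n"
  by (simp add: parity_sign_def)

lemma unit_bounded_weights:
  "unit_bounded parity_sign" "unit_bounded odd_weight" "unit_bounded even_weight"
  "unit_bounded alt_weight" "unit_bounded chi4" "unit_bounded (\<lambda>_. 1)"
  by (auto simp: unit_bounded_def parity_sign_def odd_weight_def even_weight_def alt_weight_def chi4_def)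

interpretation odd_weight: theta_weight odd_weight
proof
  fix u0 u1 u2 u3 u4 k :: int
  assume "u0 + u1 + u2 + u3 + u4 = 0"
  \<comment> \<open>An even number of the five entries is odd. If one of them is odd, another is
    therefore even; the shifts of k then have both parities and one factor on the left
    vanishes.\<close>
  then have "even (u0 + u1 + u2 + u3 + u4)"
    by simp
  then show "odd_weight (k + u0) * odd_weight (k + u1) * odd_weight (k + u2) * odd_weight (k + u3) * odd_weight (k + u4) =
      odd_weight k * of_bool (even u0 \<and> even u1 \<and> even u2 \<and> even u3 \<and> even u4)"
    by (auto simp: odd_weight_def)
qed (auto simp: odd_weight_def unit_bounded_weights)

interpretation even_weight: theta_weight even_weight
proof
  fix u0 u1 u2 u3 u4 k :: int
  assume "u0 + u1 + u2 + u3 + u4 = 0"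
  then have "even (u0 + u1 + u2 + u3 + u4)"
    by simp
  then show "even_weight (k + u0) * even_weight (k + u1) * even_weight (k + u2) * even_weight (k + u3) * even_weight (k + u4) =
      even_weight k * of_bool (even u0 \<and> even u1 \<and> even u2 \<and> even u3 \<and> even u4)"
    by (auto simp: even_weight_def)
qed (auto simp: even_weight_def unit_bounded_weights)

lemma alt_weight_double [simp]: "alt_weight (2 * n) = parity_sign n"
  by (simp add: alt_weight_def)

interpretation alt_weight: theta_weight alt_weight
proof
  fix m n :: int
  show "alt_weight (- n) = alt_weight n"
  proof (cases "even n")
    case True
    then obtain k where "n = 2 * k" by blast
    then have "- n = 2 * (- k)" by simp
    with \<open>n = 2 * k\<close> show ?thesis
      by (simp only: alt_weight_double) (simp add: parity_sign_def)
  qed (simp add: alt_weight_def)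
  show "alt_weight (5 * n) = alt_weight n"
  proof (cases "even n")
    case True
    then obtain k where "n = 2 * k" by blast
    then have "5 * n = 2 * (5 * k)" by simp
    with \<open>n = 2 * k\<close> show ?thesis
      by (simp only: alt_weight_double) (simp add: parity_sign_def)
  qed (simp add: alt_weight_def)
  show "alt_weight (2 * m + n) * alt_weight (2 * n - m) = alt_weight m * alt_weight n"
  proof (cases "even m \<and> even n")
    case True
    then obtain k l where kl: "m = 2 * k" "n = 2 * l" by blast
    have "2 * m + n = 2 * (2 * k + l)" "2 * n - m = 2 * (2 * l - k)"
      using kl by auto
    with kl show ?thesis
      by (simp only: alt_weight_double) (simp add: parity_sign_def)
  qed (auto simp: alt_weight_def)
next
  fix u0 u1 u2 u3 u4 k :: int
  assume sum: "u0 + u1 + u2 + u3 + u4 = 0"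
  then have par: "even (u0 + u1 + u2 + u3 + u4)"
    by simp
  show "alt_weight (k + u0) * alt_weight (k + u1) * alt_weight (k + u2) * alt_weight (k + u3) * alt_weight (k + u4) =
      alt_weight k * of_bool (even u0 \<and> even u1 \<and> even u2 \<and> even u3 \<and> even u4)"
  proof (cases "even k \<and> even u0 \<and> even u1 \<and> even u2 \<and> even u3 \<and> even u4")
    case True
    then obtain l v0 v1 v2 v3 v4 where k: "k = 2 * l" and u: "u0 = 2 * v0" "u1 = 2 * v1" "u2 = 2 * v2" "u3 = 2 * v3" "u4 = 2 * v4"
      by (elim conjE evenE) blast
    have *: "alt_weight (k + 2 * v) = parity_sign l * parity_sign v" for v
      unfolding k distrib_left[symmetric] alt_weight_double parity_sign_add ..
    have "v0 + v1 + v2 + v3 + v4 = 0"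
      using sum unfolding u by linarith
    then have "parity_sign (v0 + v1 + v2 + v3 + v4) = 1"
      by (simp add: parity_sign_def)
    then have v: "parity_sign v0 * parity_sign v1 * parity_sign v2 * parity_sign v3 * parity_sign v4 = 1"
      unfolding parity_sign_add .
    have l: "parity_sign l * parity_sign l = 1"
      by (simp add: parity_sign_def)
    have "alt_weight (k + u0) * alt_weight (k + u1) * alt_weight (k + u2) * alt_weight (k + u3) * alt_weight (k + u4) =
        (parity_sign l * parity_sign l) * (parity_sign l * parity_sign l) * parity_sign l *
        (parity_sign v0 * parity_sign v1 * parity_sign v2 * parity_sign v3 * parity_sign v4)"
      unfolding u * by (simp only: mult_ac)
    also have "\<dots> = alt_weight k"
      unfolding l v by (simp add: k)
    finally show ?thesis
      using True by simp
  qed (use par in \<open>auto simp: alt_weight_def\<close>)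
qed (simp add: unit_bounded_weights)

text \<open>With q = a^4 these are the classical \<open>\<theta>\<^sub>2(q)\<close>,
  \<open>\<theta>\<^sub>3(q)\<close>, \<open>\<theta>\<^sub>4(q)\<close>: summing over n = 2 m or n
  = 2 m + 1 avoids the half-integral exponents of \<open>\<theta>\<^sub>2\<close>.\<close>

abbreviation "theta2 \<equiv> theta odd_weight"
abbreviation "theta3 \<equiv> theta even_weight"
abbreviation "theta4 \<equiv> theta alt_weight"

section \<open>Relations between theta constants at q and at q^2\<close>

lemma chi4_double_add_1 [simp]: "chi4 (2 * n + 1) = parity_sign n"
  by (simp add: chi4_def)

lemma theta_odd_function:
  assumes "\<And>n. c (- n) = - c n"
  shows "theta c a = 0"
proof -
  have "theta c a = infsum (\<lambda>n. - (c n * a powi n\<^sup>2)) UNIV"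
    unfolding theta_def
    by (rule infsum_reindex_bij_witness[where i = uminus and j = uminus]) (auto simp: assms)
  then show ?thesis
    by (simp add: infsum_uminus theta_def)
qed

lemma theta_chi4: "theta chi4 a = 0"
proof (rule theta_odd_function)
  fix n
  show "chi4 (- n) = - chi4 n"
  proof (cases "odd n")
    case True
    then obtain k where n: "n = 2 * k + 1" by (rule oddE)
    then have "- n = 2 * (- k - 1) + 1" by simp
    with n show ?thesis
      by (simp only: chi4_double_add_1) (simp add: parity_sign_def)
  qed (simp add: chi4_def)
qed

text \<open>The map (m, n) to (m + n, m - n) doubles the norm and is a bijection onto the pairs of
  even sum; \<open>zero\<close> discards the other pairs. The second product in \<open>split\<close>
  allows for weights that factor only after separation by residue classes.\<close>

lemma theta_rotate:
  assumes a: "0 < a" "a < 1"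
    and bounded: "unit_bounded f" "unit_bounded g" "unit_bounded p" "unit_bounded q"
      "unit_bounded p'" "unit_bounded q'"
    and zero: "\<And>m n. odd (m + n) \<Longrightarrow> f m * g n = 0"
    and split: "\<And>m n. f (m + n) * g (m - n) = p m * q n + s * (p' m * q' n)"
  shows "theta f a * theta g a = theta p (a\<^sup>2) * theta q (a\<^sup>2) + s * (theta p' (a\<^sup>2) * theta q' (a\<^sup>2))"
proof -
  have a2: "0 < a\<^sup>2" "a\<^sup>2 < 1"
    using a by (simp_all add: power_less_one_iff)
  have "((\<lambda>(m, n). (f m * a powi m\<^sup>2) * (g n * a powi n\<^sup>2)) has_sum theta f a * theta g a) (UNIV \<times> UNIV)"
    by (intro has_sum_times has_sum_theta a bounded)
  then have "((\<lambda>(m, n). (f m * a powi m\<^sup>2) * (g n * a powi n\<^sup>2)) has_sum theta f a * theta g a) {(m, n). even (m + n)}"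
  proof (rule has_sum_cong_neutral[THEN iffD1, rotated -1])
    show "(case z of (m, n) \<Rightarrow> (f m * a powi m\<^sup>2) * (g n * a powi n\<^sup>2)) = 0"
      if "z \<in> UNIV \<times> UNIV - {(m, n). even (m + n)}" for z
      using that zero[of "fst z" "snd z"] by (cases z) auto
  qed auto
  then have "((\<lambda>(m, n). (p m * (a\<^sup>2) powi m\<^sup>2) * (q n * (a\<^sup>2) powi n\<^sup>2) +
      s * ((p' m * (a\<^sup>2) powi m\<^sup>2) * (q' n * (a\<^sup>2) powi n\<^sup>2))) has_sum theta f a * theta g a) (UNIV \<times> UNIV)"
  proof (rule has_sum_reindexI[where j = "\<lambda>(m, n). (m + n, m - n)"
        and i = "\<lambda>(m, n). ((m + n) div 2, (m - n) div 2)"], goal_cases)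
    case (5 b)
    obtain m n where b: "b = (m, n)" by force
    have "(m + n)\<^sup>2 + (m - n)\<^sup>2 = 2 * m\<^sup>2 + 2 * n\<^sup>2"
      by (simp add: power2_eq_square algebra_simps)
    then have "a powi (m + n)\<^sup>2 * a powi (m - n)\<^sup>2 = (a\<^sup>2) powi m\<^sup>2 * (a\<^sup>2) powi n\<^sup>2"
      using a by (simp add: power_int_power flip: power_int_add)
    then have "(f (m + n) * a powi (m + n)\<^sup>2) * (g (m - n) * a powi (m - n)\<^sup>2) =
        (f (m + n) * g (m - n)) * ((a\<^sup>2) powi m\<^sup>2 * (a\<^sup>2) powi n\<^sup>2)"
      by (metis mult.assoc mult.left_commute)
    then show ?case
      unfolding b prod.case split by (simp add: algebra_simps)
  qed (auto; presburger)+
  moreover have "((\<lambda>z. (case z of (m, n) \<Rightarrow> (p m * (a\<^sup>2) powi m\<^sup>2) * (q n * (a\<^sup>2) powi n\<^sup>2)) +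
      s * (case z of (m, n) \<Rightarrow> (p' m * (a\<^sup>2) powi m\<^sup>2) * (q' n * (a\<^sup>2) powi n\<^sup>2))) has_sum
      theta p (a\<^sup>2) * theta q (a\<^sup>2) + s * (theta p' (a\<^sup>2) * theta q' (a\<^sup>2))) (UNIV \<times> UNIV)"
    by (intro has_sum_add has_sum_cmult_right has_sum_times has_sum_theta a2 bounded)
  then have "((\<lambda>(m, n). (p m * (a\<^sup>2) powi m\<^sup>2) * (q n * (a\<^sup>2) powi n\<^sup>2) +
      s * ((p' m * (a\<^sup>2) powi m\<^sup>2) * (q' n * (a\<^sup>2) powi n\<^sup>2))) has_sum
      theta p (a\<^sup>2) * theta q (a\<^sup>2) + s * (theta p' (a\<^sup>2) * theta q' (a\<^sup>2))) (UNIV \<times> UNIV)"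
    by (rule has_sum_cong[THEN iffD1, rotated]) auto
  ultimately show ?thesis
    by (rule has_sum_unique)
qed

lemma theta3_square:
  assumes "0 < a" "a < 1"
  shows "(theta3 a)\<^sup>2 = (theta3 (a\<^sup>2))\<^sup>2 + (theta2 (a\<^sup>2))\<^sup>2"
  using theta_rotate[OF assms, of even_weight even_weight even_weight even_weight odd_weight odd_weight 1]
  by (simp add: unit_bounded_weights power2_eq_square) (auto simp: even_weight_def odd_weight_def)

lemma theta2_square:
  assumes "0 < a" "a < 1"
  shows "(theta2 a)\<^sup>2 = 2 * (theta2 (a\<^sup>2) * theta3 (a\<^sup>2))"
  using theta_rotate[OF assms, of odd_weight odd_weight odd_weight even_weight even_weight odd_weight 1]
  by (simp add: unit_bounded_weights power2_eq_square) (auto simp: even_weight_def odd_weight_def)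

lemma theta4_square:
  assumes "0 < a" "a < 1"
  shows "(theta4 a)\<^sup>2 = (theta3 (a\<^sup>2))\<^sup>2 - (theta2 (a\<^sup>2))\<^sup>2"
proof -
  have "alt_weight (m + n) * alt_weight (m - n) = even_weight m * even_weight n + - 1 * (odd_weight m * odd_weight n)" for m n
  proof (cases "even (m + n)")
    case True
    then obtain k where k: "m + n = 2 * k" by blast
    then have m: "m = 2 * k - n" by simp
    then have "m - n = 2 * (k - n)" by simp
    with k show ?thesis
      by (simp only: alt_weight_double) (simp add: m parity_sign_def even_weight_def odd_weight_def)
  qed (auto simp: alt_weight_def even_weight_def odd_weight_def)
  then show ?thesis
    using theta_rotate[OF assms, of alt_weight alt_weight even_weight even_weight odd_weight odd_weight "- 1"]
    by (simp add: unit_bounded_weights power2_eq_square) (auto simp: alt_weight_def)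
qed

text \<open>Pairs m, n of even numbers give the right-hand side. Pairs of odd numbers carry the
  weight \<open>chi4 m * chi4 n\<close> and contribute nothing by \<open>theta_chi4\<close>.\<close>

lemma theta3_theta4:
  assumes "0 < a" "a < 1"
  shows "theta3 a * theta4 a = (theta4 (a\<^sup>2))\<^sup>2"
proof -
  have "even_weight (m + n) * alt_weight (m - n) = alt_weight m * alt_weight n + 1 * (chi4 m * chi4 n)" for m n
  proof (cases "even (m + n)")
    case True
    show ?thesis
    proof (cases "even m")
      case True
      with \<open>even (m + n)\<close> obtain k l where m: "m = 2 * k" "n = 2 * l"
        by (metis dvd_add_right_iff evenE)
      then have "m - n = 2 * (k - l)" by simp
      with m show ?thesis
        by (simp only: alt_weight_double) (simp add: parity_sign_def even_weight_def chi4_def)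
    next
      case False
      with \<open>even (m + n)\<close> obtain k l where m: "m = 2 * k + 1" "n = 2 * l + 1"
        by (metis even_add oddE)
      then have "m - n = 2 * (k - l)" by simp
      with m show ?thesis
        by (simp only: alt_weight_double) (simp add: parity_sign_def even_weight_def alt_weight_def chi4_def)
    qed
  qed (auto simp: alt_weight_def even_weight_def chi4_def)
  then show ?thesis
    using theta_rotate[OF assms, of even_weight alt_weight alt_weight alt_weight chi4 chi4 1]
    by (simp add: unit_bounded_weights theta_chi4 power2_eq_square) (auto simp: alt_weight_def even_weight_def)
qed

text \<open>With A and B the squares of \<open>theta3\<close> and \<open>theta2\<close> at a^2, this
  is (A + B)^2 - (A - B)^2 = 4 A B.\<close>

lemma jacobi_quartic:
  assumes "0 < a" "a < 1"
  shows "theta2 a ^ 4 + theta4 a ^ 4 = theta3 a ^ 4"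
proof -
  have "theta2 a ^ 4 + theta4 a ^ 4 = ((theta2 a)\<^sup>2)\<^sup>2 + ((theta4 a)\<^sup>2)\<^sup>2"
    by simp
  also have "\<dots> = ((theta3 a)\<^sup>2)\<^sup>2"
    unfolding theta2_square[OF assms] theta3_square[OF assms] theta4_square[OF assms]
    by (simp add: power2_eq_square algebra_simps)
  finally show ?thesis by simp
qed

section \<open>Signs and sizes of theta series at small arguments\<close>

lemma theta_pos:
  assumes "unit_bounded c" "\<And>n. 0 \<le> c n" "0 < c k" "0 < a" "a < 1"
  shows "0 < theta c a"
proof -
  have "(\<Sum>n\<in>{k}. c n * a powi n\<^sup>2) \<le> theta c a"
    by (rule finite_sum_le_has_sum[OF has_sum_theta[OF assms(1,4,5)]]) (use assms in auto)
  moreover have "0 < c k * a powi k\<^sup>2"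
    using assms by simp
  ultimately show ?thesis by simp
qed

lemma greaterThanLessThan_int_simps:
  "{-1<..<1::int} = {0}" "{-2<..<2::int} = {-1, 0, 1}" "{-3<..<3::int} = {-2, -1, 0, 1, 2}"
  "{-5<..<5::int} = {-4, -3, -2, -1, 0, 1, 2, 3, 4}"
  by auto

lemma theta4_pos:
  assumes "0 < a" "a \<le> 1 / 2"
  shows "0 < theta4 a"
proof -
  have "4 * a ^ 4 < 1"
    using power_mono[of a "1 / 2" 4] assms by (simp add: power_divide)
  moreover have "\<bar>theta4 a - 1\<bar> \<le> 4 * a ^ 4"
    using theta_approx[OF unit_bounded_weights(4) assms, of 2]
    by (simp add: greaterThanLessThan_int_simps alt_weight_def parity_sign_def)
  ultimately show ?thesis
    by linarith
qed

lemma residue_theta_even_pos: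
  assumes y: "0 < y" "y < 1"
  shows "0 < residue_theta even_weight y 1 * residue_theta even_weight y 2"
proof (rule mult_pos_pos)
  show "0 < residue_theta even_weight y 1"
    unfolding residue_theta_def
    \<comment> \<open>The even number of least absolute value in the class of 1 modulo 5 is
      -4.\<close>
    by (rule theta_pos[OF even_weight.bounded_residue, where k = "- 4"]) (use y in \<open>auto simp: even_weight_def\<close>)
  show "0 < residue_theta even_weight y 2"
    unfolding residue_theta_def
    by (rule theta_pos[OF even_weight.bounded_residue, where k = 2]) (use y in \<open>auto simp: even_weight_def\<close>)
qed

text \<open>The leading terms are + y^16 from n = -4 in class 1 and - y^4 from n = 2 in class 2.
  They outweigh the tail bounds 4 y^25 and 4 y^9.\<close>

lemma residue_theta_alt_neg:
  assumes y: "0 < y" "y \<le> 1 / 4"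
  shows "residue_theta alt_weight y 1 * residue_theta alt_weight y 2 < 0"
proof -
  have y_small: "4 * y ^ 25 < y ^ 16" "4 * y ^ 9 < y ^ 4"
  proof -
    have "4 * y ^ 5 < 1"
      using power_mono[of y "1 / 4" 5] y by (simp add: power_divide)
    then have "4 * y ^ 5 * y ^ 4 < 1 * y ^ 4"
      by (intro mult_strict_right_mono) (use y in auto)
    then show "4 * y ^ 9 < y ^ 4"
      by (simp add: eval_nat_numeral)
    have "y ^ 9 \<le> y ^ 5" by (rule power_decreasing) (use y in auto)
    then have "4 * y ^ 9 < 1" using \<open>4 * y ^ 5 < 1\<close> by simp
    then have "4 * y ^ 9 * y ^ 16 < 1 * y ^ 16"
      by (intro mult_strict_right_mono) (use y in auto)
    then show "4 * y ^ 25 < y ^ 16"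
      by (simp add: eval_nat_numeral)
  qed
  have "0 < residue_theta alt_weight y 1"
    using theta_approx[OF alt_weight.bounded_residue[of 1] y(1), of 5] y y_small
    by (simp add: residue_theta_def greaterThanLessThan_int_simps alt_weight_def parity_sign_def power_int_def)
  moreover have "residue_theta alt_weight y 2 < 0"
    using theta_approx[OF alt_weight.bounded_residue[of 2] y(1), of 3] y y_small
    by (simp add: residue_theta_def greaterThanLessThan_int_simps alt_weight_def parity_sign_def power_int_def)
  ultimately show ?thesis
    by (rule mult_pos_neg)
qed

text \<open>The identity of the overview with q = w^40, which makes every argument an integral power
  of w. Thus \<open>\<theta>\<^sub>2(q^(1/2))\<close> is \<open>theta2 (w ^ 5)\<close> and
  \<open>\<theta>\<^sub>4(q^2)\<close> is \<open>theta4 (w ^ 20)\<close>. The dissection modulo 5 is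
  applied at y = w^2, so that b = y^5 belongs to q and b^5 to q^5.\<close>

lemma theta_quintic_identity:
  assumes w: "0 < w" "w \<le> 1 / 2"
  shows "theta3 (w ^ 10) ^ 3 - 3 * theta3 (w ^ 10) * (theta3 (w ^ 50))\<^sup>2 =
    theta2 (w ^ 5) * theta2 (w ^ 25) * theta2 (w ^ 50) - 2 * (theta4 (w ^ 20) * theta4 (w ^ 100)) * theta4 (w ^ 50)"
proof -
  define y where "y = w\<^sup>2"
  have pow_lt: "0 < w ^ k" "w ^ k < 1" if "0 < k" for k
    using w that by (auto simp: power_less_one_iff)
  have y: "0 < y" "y < 1" "y \<le> 1 / 4"
    using pow_lt[of 2] power_mono[of w "1 / 2" 2] w by (auto simp: y_def power2_eq_square)
  have a: "0 < y ^ k" "y ^ k < 1" if "0 < k" for k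
    using y that by (auto simp: power_less_one_iff)
  have a5: "y ^ 5 \<le> 1 / 1024"
    using power_mono[of y "1 / 4" 5] y by (simp add: power_divide)
  define b where "b = y ^ 5"
  have b: "0 < b" "b < 1" "b \<le> 1 / 1024"
    using a[of 5] a5 by (auto simp: b_def)
  have b5: "0 < b ^ 5" "b ^ 5 < 1" "b ^ 5 \<le> 1 / 1024"
    using b power_decreasing[of 1 5 b] by (auto simp: power_less_one_iff)
  have "b ^ 3 \<le> b ^ 1" "b ^ 4 \<le> b ^ 1"
    using b by (intro power_decreasing; simp)+
  then have "b ^ 3 \<le> 1 / 1024" "b ^ 4 \<le> 1 / 1024"
    using b by auto
  then have "b * b ^ 3 \<le> b * (1 / 1024)" "b * b ^ 4 \<le> b * (1 / 1024)"
    using b by (intro mult_left_mono; simp)+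
  then have b4: "b ^ 4 \<le> b / 1024" "b ^ 5 \<le> b / 1024"
    by (simp_all add: eval_nat_numeral)
  have pos: "0 < theta2 b" "0 < theta3 b" "0 < theta2 (b ^ 5)" "0 < theta3 (b ^ 5)"
    using theta_pos[of odd_weight 1] theta_pos[of even_weight 0] b b5
    by (auto simp: unit_bounded_weights odd_weight_def even_weight_def)
  \<comment> \<open>These crude bounds suffice for the ratio hypotheses: \<open>theta2 b\<close> is
    close to 2 b, \<open>theta2 (b ^ 5)\<close> is at most of order b^5, and both values of
    \<open>theta3\<close> are close to 1.\<close>
  have t2: "2 * b - 4 * b ^ 4 \<le> theta2 b"
    using theta_approx[OF unit_bounded_weights(2) b(1), of 2] b
    by (simp add: greaterThanLessThan_int_simps odd_weight_def)
  have s2: "theta2 (b ^ 5) \<le> 4 * b ^ 5"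
    using theta_approx[OF unit_bounded_weights(2) b5(1), of 1] b5
    by (simp add: greaterThanLessThan_int_simps odd_weight_def)
  have t3: "theta3 b \<le> 1 + 4 * b ^ 4"
    using theta_approx[OF unit_bounded_weights(3) b(1), of 2] b
    by (simp add: greaterThanLessThan_int_simps even_weight_def)
  have s3: "1 - 4 * (b ^ 5) ^ 4 \<le> theta3 (b ^ 5)"
    using theta_approx[OF unit_bounded_weights(3) b5(1), of 2] b5
    by (simp add: greaterThanLessThan_int_simps even_weight_def)
  have b54: "(b ^ 5) ^ 4 \<le> b ^ 5"
    using b5 power_decreasing[of 1 4 "b ^ 5"] by simp
  have pos4: "0 < theta4 b" "0 < theta4 (b ^ 5)"
    using theta4_pos b b5 by auto
  have r2: "3 * theta2 (b ^ 5) < theta2 b"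
    using t2 s2 b4 b by linarith
  have "theta3 b \<le> 11 / 10" "95 / 100 \<le> theta3 (b ^ 5)"
    using t3 s3 b4 b54 b b5 by linarith+
  then have "(theta3 b)\<^sup>2 \<le> (11 / 10)\<^sup>2" "(95 / 100)\<^sup>2 \<le> (theta3 (b ^ 5))\<^sup>2"
    using pos by (auto intro: power_mono)
  then have r3: "(theta3 b)\<^sup>2 < 3 / 2 * (theta3 (b ^ 5))\<^sup>2"
    by (simp add: power2_eq_square)
  have b25: "b ^ 5 = y ^ 25"
    by (simp add: b_def flip: power_mult)
  \<comment> \<open>The square of 4 R1 R2, times R0, is 16 R0 (R1 R2)^2; the 5 comes from the five
    cyclic shifts counted in \<open>residue_theta_product\<close>.\<close>
  define K where "K = 16 / 5 * isogeny_constant y"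
  have quintic: "((theta c b)\<^sup>2 - (theta c (b ^ 5))\<^sup>2)\<^sup>2 * theta c (b ^ 5) = K * theta c b"
    and diff: "(theta c b)\<^sup>2 - (theta c (b ^ 5))\<^sup>2 = 4 * (residue_theta c y 1 * residue_theta c y 2)"
    if "theta_weight c" for c
  proof -
    have g: "gauss_weight c"
      using that by (rule theta_weight.axioms(1))
    have s: "theta c (b ^ 5) = residue_theta c y 0"
      unfolding b25 using gauss_weight.residue_theta_0[OF g y(1,2)] by simp
    show d: "(theta c b)\<^sup>2 - (theta c (b ^ 5))\<^sup>2 = 4 * (residue_theta c y 1 * residue_theta c y 2)"
      using gauss_weight.theta_square_dissection[OF g y(1,2), folded b_def] unfolding s by simp
    show "((theta c b)\<^sup>2 - (theta c (b ^ 5))\<^sup>2)\<^sup>2 * theta c (b ^ 5) = K * theta c b"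
      using theta_weight.residue_theta_product[OF that y(1,2), folded b_def]
      unfolding d unfolding s by (simp add: K_def power2_eq_square mult_ac)
  qed
  note weights = odd_weight.theta_weight_axioms even_weight.theta_weight_axioms alt_weight.theta_weight_axioms
  have "0 < residue_theta even_weight y 1 * residue_theta even_weight y 2"
    using y(1,2) by (rule residue_theta_even_pos)
  then have "(theta3 (b ^ 5))\<^sup>2 < (theta3 b)\<^sup>2"
    using diff[OF weights(2)] by simp
  then have r3': "theta3 (b ^ 5) < theta3 b"
    using pos power_less_imp_less_base[of "theta3 (b ^ 5)" 2] by auto
  have "residue_theta alt_weight y 1 * residue_theta alt_weight y 2 < 0"
    using y(1,3) by (rule residue_theta_alt_neg)
  then have "(theta4 b)\<^sup>2 < (theta4 (b ^ 5))\<^sup>2"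
    using diff[OF weights(3)] by simp
  then have r4: "theta4 b < theta4 (b ^ 5)"
    using pos4 power_less_imp_less_base[of "theta4 b" 2] by auto
  have "0 < ((theta3 b)\<^sup>2 - (theta3 (b ^ 5))\<^sup>2)\<^sup>2 * theta3 (b ^ 5)"
    using \<open>(theta3 (b ^ 5))\<^sup>2 < (theta3 b)\<^sup>2\<close> pos by (intro mult_pos_pos) auto
  then have K: "K \<noteq> 0"
    using quintic[OF weights(2)] by auto
  have bw: "b = w ^ 10" "b ^ 5 = w ^ 50" "b = (w ^ 5)\<^sup>2" "b ^ 5 = (w ^ 25)\<^sup>2"
      "w ^ 20 = b\<^sup>2" "w ^ 100 = (b ^ 5)\<^sup>2"
    by (simp_all add: b_def y_def flip: power_mult)
  \<comment> \<open>Doubling the nome takes w^5 to b and w^25 to b^5, so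
    \<open>theta2_square\<close> applies to both factors.\<close>
  have \<alpha>: "(theta2 (w ^ 5) * theta2 (w ^ 25))\<^sup>2 = 4 * (theta2 b * theta3 b) * (theta2 (b ^ 5) * theta3 (b ^ 5))"
    unfolding power_mult_distrib 
      theta2_square[OF pow_lt[of 5, OF zero_less_numeral]] theta2_square[OF pow_lt[of 25, OF zero_less_numeral]]
    by (simp add: bw(3,4) flip: power_mult)
  have \<beta>: "(theta4 (w ^ 20) * theta4 (w ^ 100))\<^sup>2 = (theta3 b * theta4 b) * (theta3 (b ^ 5) * theta4 (b ^ 5))"
    unfolding power_mult_distrib bw(5,6) using theta3_theta4[OF b(1,2)] theta3_theta4[OF b5(1,2)] by simp
  have "theta3 b ^ 3 - 3 * theta3 b * (theta3 (b ^ 5))\<^sup>2 =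
    theta2 (w ^ 5) * theta2 (w ^ 25) * theta2 (b ^ 5) - 2 * (theta4 (w ^ 20) * theta4 (w ^ 100)) * theta4 (b ^ 5)"
  proof (rule theta_quintic_algebra[OF K])
    show "0 \<le> theta2 (w ^ 5) * theta2 (w ^ 25)"
      using theta_pos[of odd_weight 1 "w ^ 5"] theta_pos[of odd_weight 1 "w ^ 25"] pow_lt[of 5] pow_lt[of 25]
      by (auto simp: unit_bounded_weights odd_weight_def)
    show "0 \<le> theta4 (w ^ 20) * theta4 (w ^ 100)"
      using theta4_pos[of "w ^ 20"] theta4_pos[of "w ^ 100"] pow_lt[of 20] pow_lt[of 100]
        power_decreasing[of 1 20 w] power_decreasing[of 1 100 w] w by auto
  qed (use pos pos4 r2 r3 r3' r4 quintic[OF weights(1)] quintic[OF weights(2)] quintic[OF weights(3)]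
      jacobi_quartic[OF b(1,2)] jacobi_quartic[OF b5(1,2)] \<alpha> \<beta> in auto)
  then show ?thesis
    unfolding bw(2) unfolding bw(1) .
qed

section \<open>Generating functions\<close>

text \<open>Grouping the sum by the value of Q gives the power series. Finiteness of the fibres
  comes with convergence, as a nonzero constant is summable only over a finite set; hence
  \<open>card\<close> is a true count.\<close>

lemma counting_series_sums:
  fixes Q :: "'a \<Rightarrow> int"
  assumes S: "((\<lambda>v. q powi Q v) has_sum S) A" and q: "0 < q" and Q: "\<And>v. v \<in> A \<Longrightarrow> 0 \<le> Q v"
  shows "(\<lambda>n. real (card {v \<in> A. Q v = int n}) * q ^ n) sums S"
proof -
  let ?F = "\<lambda>n. {v \<in> A. Q v = int n}"
  have fiber: "((\<lambda>v. q powi Q v) has_sum (real (card (?F n)) * q ^ n)) (?F n)" for n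
  proof -
    have "(\<lambda>v. q powi Q v) summable_on ?F n"
      using has_sum_imp_summable[OF S] by (rule summable_on_subset_banach) auto
    then have "(\<lambda>v. q ^ n) summable_on ?F n"
      by (rule summable_on_cong[THEN iffD1, rotated]) (auto simp: power_int_of_nat)
    then have "finite (?F n)"
      using infsum_diverge_constant[of "?F n" "q ^ n"] q by auto
    then show ?thesis
      by (intro has_sum_finiteI) (auto simp: power_int_of_nat)
  qed
  have "((\<lambda>(n, v). q powi Q v) has_sum S) (Sigma UNIV ?F)"
    by (rule has_sum_reindexI[OF S, where j = snd and i = "\<lambda>v. (nat (Q v), v)"]) (auto simp: Q)
  then have "((\<lambda>n. real (card (?F n)) * q ^ n) has_sum S) UNIV"
    by (rule has_sum_SigmaD) (use fiber in auto)
  then show ?thesis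
    by (rule has_sum_imp_sums)
qed

text \<open>The sum function tends to \<open>h 0\<close> at 0, and it is identically zero on a right
  neighbourhood of 0. Only positive q are available, hence the one-sided limit.\<close>

lemma power_series_coeff_0:
  fixes h :: "nat \<Rightarrow> real"
  assumes e: "0 < e" and h: "\<And>q. 0 < q \<Longrightarrow> q < e \<Longrightarrow> (\<lambda>n. h n * q ^ n) sums 0"
  shows "h 0 = 0"
proof -
  define f where "f x = (\<Sum>n. h n * x ^ n)" for x
  have "(\<lambda>n. h n * x ^ n) sums f x" if "norm x < e / 2" for x
    unfolding f_def
  proof (rule summable_sums, rule powser_inside)
    show "summable (\<lambda>n. h n * (e / 2) ^ n)"
      using h[of "e / 2"] e by (auto simp: sums_iff)
  qed (use that e in auto)
  then have "(f \<longlongrightarrow> h 0) (at 0)"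
    using e by (intro powser_limit_0[of "e / 2"]) auto
  then have "(f \<longlongrightarrow> h 0) (at_right 0)"
    by (rule filterlim_mono) (auto simp: at_le)
  moreover have "eventually (\<lambda>x. f x = 0) (at_right 0)"
    unfolding eventually_at_right_field using e h by (auto simp: f_def sums_iff)
  then have "(f \<longlongrightarrow> 0) (at_right 0)"
    by (rule tendsto_eventually)
  ultimately show ?thesis
    using tendsto_unique[of "at_right (0::real)"] by auto
qed

text \<open>Once the coefficients before n vanish, division by q^n moves coefficient n to position
  0.\<close>

lemma power_series_coeffs_0:
  fixes h :: "nat \<Rightarrow> real"
  assumes e: "0 < e" and h: "\<And>q. 0 < q \<Longrightarrow> q < e \<Longrightarrow> (\<lambda>n. h n * q ^ n) sums 0"
  shows "h n = 0"
proof (induction n rule: less_induct)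
  case (less n)
  have "h (0 + n) = 0"
  proof (rule power_series_coeff_0[OF e, where h = "\<lambda>m. h (m + n)"])
    fix q :: real
    assume q: "0 < q" "q < e"
    have "(\<lambda>m. h (m + n) * q ^ (m + n)) sums (0 - (\<Sum>i<n. h i * q ^ i))"
      using h[OF q] by (subst sums_iff_shift) simp
    then have "(\<lambda>m. h (m + n) * q ^ (m + n) / q ^ n) sums (0 / q ^ n)"
      by (intro sums_divide) (simp add: less)
    then show "(\<lambda>m. h (m + n) * q ^ m) sums 0"
      using q by (simp add: power_add)
  qed
  then show ?case by simp
qed

lemma power_series_coeffs_eq:
  fixes f g :: "nat \<Rightarrow> real"
  assumes "0 < e"
    and "\<And>q. 0 < q \<Longrightarrow> q < e \<Longrightarrow> \<exists>S. (\<lambda>n. f n * q ^ n) sums S \<and> (\<lambda>n. g n * q ^ n) sums S"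
  shows "f n = g n"
proof -
  have "f n - g n = 0"
  proof (rule power_series_coeffs_0[OF assms(1), where h = "\<lambda>n. f n - g n"])
    fix q :: real
    assume "0 < q" "q < e"
    then obtain S where "(\<lambda>n. f n * q ^ n) sums S" "(\<lambda>n. g n * q ^ n) sums S"
      using assms(2) by blast
    then have "(\<lambda>n. f n * q ^ n - g n * q ^ n) sums (S - S)"
      by (rule sums_diff)
    then show "(\<lambda>n. (f n - g n) * q ^ n) sums 0"
      by (simp add: algebra_simps)
  qed
  then show ?thesis by simp
qed

section \<open>Diagonal forms and their values at multiples of 5\<close>

lemma has_sum_theta_triple:
  assumes "unit_bounded f" "unit_bounded g" "unit_bounded h"
    and "0 < a" "a < 1" "0 < b" "b < 1" "0 < c" "c < 1"
  shows "((\<lambda>(x, y, z). f x * g y * h z * (a powi x\<^sup>2 * b powi y\<^sup>2 * c powi z\<^sup>2)) has_sum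
    theta f a * theta g b * theta h c) UNIV"
proof -
  have "((\<lambda>(x, v). (f x * a powi x\<^sup>2) * (case v of (y, z) \<Rightarrow> (g y * b powi y\<^sup>2) * (h z * c powi z\<^sup>2)))
      has_sum theta f a * (theta g b * theta h c)) (UNIV \<times> UNIV \<times> UNIV)"
    by (intro has_sum_times has_sum_theta assms)
  then show ?thesis
    by (simp add: case_prod_unfold mult_ac)
qed

abbreviation "theta_all \<equiv> theta (\<lambda>_. 1)"

text \<open>Passes between the two normalisations: sums over all integers in q = a^4, natural for
  counting, and sums over even integers in a, used for the theta constants.\<close>

lemma theta_double:
  assumes "unit_bounded f" "0 < a" "a < 1" and g: "\<And>n. g (2 * n) = f n" "\<And>n. odd n \<Longrightarrow> g n = 0"
  shows "theta g a = theta f (a ^ 4)"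
proof -
  have "unit_bounded g"
    unfolding unit_bounded_def using g assms(1) by (metis abs_zero evenE unit_boundedD zero_le_one)
  then have "((\<lambda>n. g n * a powi n\<^sup>2) has_sum theta g a) UNIV"
    using assms by (intro has_sum_theta)
  then have "((\<lambda>n. g n * a powi n\<^sup>2) has_sum theta g a) {n. even n}"
    by (rule has_sum_cong_neutral[THEN iffD1, rotated -1]) (auto simp: g)
  then have "((\<lambda>n. f n * (a ^ 4) powi n\<^sup>2) has_sum theta g a) UNIV"
    by (rule has_sum_reindexI[where j = "\<lambda>n. 2 * n" and i = "\<lambda>n. n div 2"])
      (auto simp: g power_int_power power_mult_distrib)
  moreover have "((\<lambda>n. f n * (a ^ 4) powi n\<^sup>2) has_sum theta f (a ^ 4)) UNIV"
    using assms by (intro has_sum_theta) (auto simp: power_less_one_iff)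
  ultimately show ?thesis
    by (rule has_sum_unique)
qed

lemma theta_all_fourth_power: "0 < a \<Longrightarrow> a < 1 \<Longrightarrow> theta_all (a ^ 4) = theta3 a"
  by (rule theta_double[symmetric]) (auto simp: even_weight_def unit_bounded_weights)

lemma theta_sign_fourth_power: "0 < a \<Longrightarrow> a < 1 \<Longrightarrow> theta parity_sign (a ^ 4) = theta4 a"
  by (rule theta_double[symmetric]) (auto simp: alt_weight_def unit_bounded_weights)

lemma diagonal_form_sums:
  fixes a b c :: nat
  assumes abc: "0 < a" "0 < b" "0 < c" and q: "0 < q" "q < 1"
  shows "(\<lambda>n. real (rep_count (int a) (int b) (int c) 0 0 0 (int n)) * q ^ n) sums
    (theta_all (q ^ a) * theta_all (q ^ b) * theta_all (q ^ c))"
proof -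
  have pow: "0 < q ^ k" "q ^ k < 1" if "0 < k" for k
    using q that by (auto simp: power_less_one_iff)
  have "((\<lambda>(x, y, z). 1 * 1 * 1 * ((q ^ a) powi x\<^sup>2 * (q ^ b) powi y\<^sup>2 * (q ^ c) powi z\<^sup>2)) has_sum
      theta_all (q ^ a) * theta_all (q ^ b) * theta_all (q ^ c)) UNIV"
    by (intro has_sum_theta_triple unit_bounded_weights pow abc)
  moreover have "(\<lambda>(x, y, z). 1 * 1 * 1 * ((q ^ a) powi x\<^sup>2 * (q ^ b) powi y\<^sup>2 * (q ^ c) powi z\<^sup>2)) =
      (\<lambda>v. q powi ternary_form (int a) (int b) (int c) 0 0 0 v)"
    using q by (auto simp: fun_eq_iff ternary_form_def power_int_power power_int_add)
  ultimately have "((\<lambda>v. q powi ternary_form (int a) (int b) (int c) 0 0 0 v) has_sum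
      theta_all (q ^ a) * theta_all (q ^ b) * theta_all (q ^ c)) UNIV"
    by simp
  from counting_series_sums[OF this q(1)] show ?thesis
    by (auto simp: rep_count_def ternary_form_def)
qed

text \<open>The constant weight does not satisfy \<open>translate\<close>; the dissections below use
  just the square formula of \<open>gauss_weight\<close>.\<close>

interpretation all_weight: gauss_weight "\<lambda>_. 1"
  by standard (auto simp: unit_bounded_weights)

lemma sum_upto_4: "sum f {0..4::int} = f 0 + f 1 + f 2 + f 3 + f 4"
proof -
  have "{0..4::int} = {0, 1, 2, 3, 4}" by auto
  then show ?thesis by (simp add: add.assoc)
qed

text \<open>Modulo 5 a sum of three squares vanishes for (0, 0, 0) and for the 24 arrangements of 0,
  \<plusminus>1, \<plusminus>2. This gives R0^3 + 24 R0 R1 R2 = 6 R0 (R0^2 + 4 R1 R2) - 5 R0^3,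
  where R0 belongs to q^5 and the bracket is the square of the theta series at q.\<close>

lemma rep_count_111_mult_5:
  "real (rep_count 1 1 1 0 0 0 (5 * int n)) =
    6 * real (rep_count 1 1 5 0 0 0 (int n)) - 5 * real (rep_count 5 5 5 0 0 0 (int n))"
proof (rule power_series_coeffs_eq[of 1 "\<lambda>n. real (rep_count 1 1 1 0 0 0 (5 * int n))"
      "\<lambda>n. 6 * real (rep_count 1 1 5 0 0 0 (int n)) - 5 * real (rep_count 5 5 5 0 0 0 (int n))"])
  fix q :: real
  assume q: "0 < q" "q < 1"
  define y where "y = root 5 q"
  have y: "0 < y" "y < 1" and yq: "q = y ^ 5"
    using q by (auto simp: y_def real_root_lt_1_iff)
  let ?f = "\<lambda>n. y powi n\<^sup>2"
  let ?C = "\<lambda>i. {n::int. n mod 5 = i}"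
  let ?R = "residue_theta (\<lambda>_. 1) y"
  let ?Q = "\<lambda>(a, b, c). a\<^sup>2 + b\<^sup>2 + c\<^sup>2 :: int"
  let ?P = "\<lambda>(i, j, k). (i\<^sup>2 + j\<^sup>2 + k\<^sup>2) mod 5 = (0::int)"
  let ?T = "{t \<in> {0..4} \<times> {0..4} \<times> {0..4}. ?P t}"
  let ?A = "{v. ?Q v mod 5 = 0}"
  have R: "(?f has_sum ?R i) (?C i)" for i
    using all_weight.has_sum_residue_theta[OF y, of i] by simp
  have "((\<lambda>(a, b). ?f a * (case b of (b, c) \<Rightarrow> ?f b * ?f c)) has_sum
      (\<Sum>t\<in>?T. case t of (i, j, k) \<Rightarrow> ?R i * (?R j * ?R k)))
      (\<Union>t\<in>?T. case t of (i, j, k) \<Rightarrow> ?C i \<times> ?C j \<times> ?C k)"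
  proof (rule sum_has_sum)
    fix t assume "t \<in> ?T"
    show "((\<lambda>(a, b). ?f a * (case b of (b, c) \<Rightarrow> ?f b * ?f c)) has_sum
        (case t of (i, j, k) \<Rightarrow> ?R i * (?R j * ?R k))) (case t of (i, j, k) \<Rightarrow> ?C i \<times> ?C j \<times> ?C k)"
      by (cases t) (auto intro!: has_sum_times R)
  qed auto
  moreover have "(\<Union>t\<in>?T. case t of (i, j, k) \<Rightarrow> ?C i \<times> ?C j \<times> ?C k) = ?A"
  proof -
    have "(a\<^sup>2 + b\<^sup>2 + c\<^sup>2) mod 5 = ((a mod 5)\<^sup>2 + (b mod 5)\<^sup>2 + (c mod 5)\<^sup>2) mod 5" for a b c :: int
      by (intro mod_add_cong) (simp_all add: power_mod)
    moreover have "n mod 5 \<le> 4" for n :: int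
      using pos_mod_bound[of 5 n] by simp
    ultimately show ?thesis
      by (simp add: set_eq_iff)
  qed
  moreover have "(\<Sum>t\<in>?T. case t of (i, j, k) \<Rightarrow> ?R i * (?R j * ?R k)) = (?R 0) ^ 3 + 24 * (?R 0 * (?R 1 * ?R 2))"
  proof -
    have "(\<Sum>t\<in>?T. case t of (i, j, k) \<Rightarrow> ?R i * (?R j * ?R k)) =
        (\<Sum>i\<in>{0..4}. \<Sum>j\<in>{0..4}. \<Sum>k\<in>{0..4}. if (i\<^sup>2 + j\<^sup>2 + k\<^sup>2) mod 5 = 0 then ?R i * (?R j * ?R k) else 0)"
      by (subst sum.inter_filter) (auto simp: sum.cartesian_product intro!: sum.cong)
    also have "\<dots> = (?R 0) ^ 3 + 24 * (?R 0 * (?R 1 * ?R 2))"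
      using all_weight.residue_theta_neg[OF y, of 1] all_weight.residue_theta_neg[OF y, of 2]
      by (simp add: sum_upto_4 eval_nat_numeral algebra_simps)
    finally show ?thesis .
  qed
  ultimately have "((\<lambda>(a, b). ?f a * (case b of (b, c) \<Rightarrow> ?f b * ?f c)) has_sum
      (?R 0) ^ 3 + 24 * (?R 0 * (?R 1 * ?R 2))) ?A"
    by simp
  then have "((\<lambda>v. q powi (?Q v div 5)) has_sum (?R 0) ^ 3 + 24 * (?R 0 * (?R 1 * ?R 2))) ?A"
  proof (rule has_sum_cong[THEN iffD1, rotated])
    fix v assume "v \<in> ?A"
    then have "int 5 * (?Q v div 5) = ?Q v"
      by auto
    then have "q powi (?Q v div 5) = y powi ?Q v"
      unfolding yq by (simp only: power_int_power)
    then show "(case v of (a, b) \<Rightarrow> ?f a * (case b of (b, c) \<Rightarrow> ?f b * ?f c)) = q powi (?Q v div 5)"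
      using y by (cases v) (simp add: power_int_add)
  qed
  then have "(\<lambda>n. real (card {v \<in> ?A. ?Q v div 5 = int n}) * q ^ n) sums ((?R 0) ^ 3 + 24 * (?R 0 * (?R 1 * ?R 2)))"
    by (rule counting_series_sums[OF _ q(1)]) (auto simp: pos_imp_zdiv_nonneg_iff)
  moreover have "{v \<in> ?A. ?Q v div 5 = int n} = {v. ternary_form 1 1 1 0 0 0 v = 5 * int n}" for n
  proof -
    have "ternary_form 1 1 1 0 0 0 v = ?Q v" for v
      by (cases v) (simp add: ternary_form_def)
    moreover have "m mod 5 = 0 \<and> m div 5 = k \<longleftrightarrow> m = 5 * k" for m k :: int
      by presburger
    ultimately show ?thesis
      by (simp only: mem_Collect_eq)
  qed
  moreover have "(?R 0) ^ 3 + 24 * (?R 0 * (?R 1 * ?R 2)) =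
      6 * (theta_all q * theta_all q * theta_all (q ^ 5)) - 5 * (theta_all (q ^ 5) * theta_all (q ^ 5) * theta_all (q ^ 5))"
  proof -
    have "theta_all (q ^ 5) = ?R 0"
      unfolding yq using all_weight.residue_theta_0[OF y] by (simp flip: power_mult)
    then show ?thesis
      using all_weight.theta_square_dissection[OF y, folded yq]
      by (simp add: power2_eq_square eval_nat_numeral algebra_simps)
  qed
  ultimately have "(\<lambda>n. real (rep_count 1 1 1 0 0 0 (5 * int n)) * q ^ n) sums
     (6 * (theta_all q * theta_all q * theta_all (q ^ 5)) - 5 * (theta_all (q ^ 5) * theta_all (q ^ 5) * theta_all (q ^ 5)))"
    by (simp add: rep_count_def)
  moreover have "(\<lambda>n. 6 * (real (rep_count 1 1 5 0 0 0 (int n)) * q ^ n) - 5 * (real (rep_count 5 5 5 0 0 0 (int n)) * q ^ n)) sums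
     (6 * (theta_all q * theta_all q * theta_all (q ^ 5)) - 5 * (theta_all (q ^ 5) * theta_all (q ^ 5) * theta_all (q ^ 5)))"
    using diagonal_form_sums[of 1 1 5, OF _ _ _ q] diagonal_form_sums[of 5 5 5, OF _ _ _ q]
    by (intro sums_diff sums_mult) simp_all
  ultimately show "\<exists>S. (\<lambda>n. real (rep_count 1 1 1 0 0 0 (5 * int n)) * q ^ n) sums S \<and>
      (\<lambda>n. (6 * real (rep_count 1 1 5 0 0 0 (int n)) - 5 * real (rep_count 5 5 5 0 0 0 (int n))) * q ^ n) sums S"
    by (auto simp: left_diff_distrib mult.assoc)
qed simp

text \<open>The residue pairs are (0, 0) and eight arrangements of \<plusminus>1, \<plusminus>2, so
  the first two variables give R0^2 + 8 R1 R2 = 2 (R0^2 + 4 R1 R2) - R0^2. The third variable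
  contributes a full theta series in q = y^5.\<close>

lemma rep_count_115_mult_5:
  "real (rep_count 1 1 5 0 0 0 (5 * int n)) =
    2 * real (rep_count 1 1 1 0 0 0 (int n)) - real (rep_count 1 5 5 0 0 0 (int n))"
proof (rule power_series_coeffs_eq[of 1 "\<lambda>n. real (rep_count 1 1 5 0 0 0 (5 * int n))"
      "\<lambda>n. 2 * real (rep_count 1 1 1 0 0 0 (int n)) - real (rep_count 1 5 5 0 0 0 (int n))"])
  fix q :: real
  assume q: "0 < q" "q < 1"
  define y where "y = root 5 q"
  have y: "0 < y" "y < 1" and yq: "q = y ^ 5"
    using q by (auto simp: y_def real_root_lt_1_iff)
  let ?f = "\<lambda>n. y powi n\<^sup>2"
  let ?C = "\<lambda>i. {n::int. n mod 5 = i}"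
  let ?R = "residue_theta (\<lambda>_. 1) y"
  let ?Q = "\<lambda>(a, b, c). a\<^sup>2 + b\<^sup>2 + 5 * c\<^sup>2 :: int"
  let ?T = "{(0, 0), (1, 2), (1, 3), (2, 1), (2, 4), (3, 1), (3, 4), (4, 2), (4, 3)} :: (int \<times> int) set"
  let ?A = "{v. ?Q v mod 5 = 0}"
  have R: "(?f has_sum ?R i) (?C i)" for i
    using all_weight.has_sum_residue_theta[OF y, of i] by simp
  have T: "((\<lambda>n. q powi n\<^sup>2) has_sum theta_all q) UNIV"
    using has_sum_theta[OF unit_bounded_weights(6) q] by simp
  have "((\<lambda>(a, b). ?f a * (case b of (b, c) \<Rightarrow> ?f b * q powi c\<^sup>2)) has_sum
      (\<Sum>t\<in>?T. case t of (i, j) \<Rightarrow> ?R i * (?R j * theta_all q)))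
      (\<Union>t\<in>?T. case t of (i, j) \<Rightarrow> ?C i \<times> ?C j \<times> UNIV)"
  proof (rule sum_has_sum)
    fix t assume "t \<in> ?T"
    show "((\<lambda>(a, b). ?f a * (case b of (b, c) \<Rightarrow> ?f b * q powi c\<^sup>2)) has_sum
        (case t of (i, j) \<Rightarrow> ?R i * (?R j * theta_all q))) (case t of (i, j) \<Rightarrow> ?C i \<times> ?C j \<times> UNIV)"
      by (cases t) (auto intro!: has_sum_times R T)
  qed auto
  moreover have "(\<Union>t\<in>?T. case t of (i, j) \<Rightarrow> ?C i \<times> ?C j \<times> UNIV) = ?A"
  proof -
    have residues: "n mod 5 = 0 \<or> n mod 5 = 1 \<or> n mod 5 = 2 \<or> n mod 5 = 3 \<or> n mod 5 = 4" for n :: int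
      by presburger
    have "(a\<^sup>2 + b\<^sup>2 + 5 * c\<^sup>2) mod 5 = 0 \<longleftrightarrow> (a mod 5, b mod 5) \<in> ?T" for a b c :: int
    proof -
      have "(a\<^sup>2 + b\<^sup>2 + 5 * c\<^sup>2) mod 5 = ((a mod 5)\<^sup>2 + (b mod 5)\<^sup>2) mod 5"
        unfolding mod_mult_self2 by (intro mod_add_cong) (simp_all add: power_mod)
      then show ?thesis
        using residues[of a] residues[of b] by (elim disjE) (simp_all only:, simp_all)
    qed
    moreover have "(a, b, c) \<in> (\<Union>t\<in>?T. case t of (i, j) \<Rightarrow> ?C i \<times> ?C j \<times> UNIV) \<longleftrightarrow> (a mod 5, b mod 5) \<in> ?T"
      for a b c :: int
      by (simp only: UN_iff bex_simps prod.case mem_Times_iff fst_conv snd_conv mem_Collect_eq insert_iff empty_iff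
        prod.inject UNIV_I simp_thms bex_simps)
    ultimately show ?thesis
      by (simp only: set_eq_iff split_paired_All mem_Collect_eq prod.case simp_thms)
  qed
  moreover have "(\<Sum>t\<in>?T. case t of (i, j) \<Rightarrow> ?R i * (?R j * theta_all q)) = ((?R 0)\<^sup>2 + 8 * (?R 1 * ?R 2)) * theta_all q"
    using all_weight.residue_theta_neg[OF y, of 1] all_weight.residue_theta_neg[OF y, of 2]
    by (simp add: power2_eq_square algebra_simps)
  ultimately have "((\<lambda>(a, b). ?f a * (case b of (b, c) \<Rightarrow> ?f b * q powi c\<^sup>2)) has_sum
      ((?R 0)\<^sup>2 + 8 * (?R 1 * ?R 2)) * theta_all q) ?A"
    by simp
  then have "((\<lambda>v. q powi (?Q v div 5)) has_sum ((?R 0)\<^sup>2 + 8 * (?R 1 * ?R 2)) * theta_all q) ?A"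
  proof (rule has_sum_cong[THEN iffD1, rotated])
    fix v assume "v \<in> ?A"
    then have "int 5 * (?Q v div 5) = ?Q v"
      by auto
    then have "q powi (?Q v div 5) = y powi ?Q v"
      unfolding yq by (simp only: power_int_power)
    moreover have "q powi c\<^sup>2 = y powi (5 * c\<^sup>2)" for c :: int
      unfolding yq by (simp add: power_int_power)
    ultimately show "(case v of (a, b) \<Rightarrow> ?f a * (case b of (b, c) \<Rightarrow> ?f b * q powi c\<^sup>2)) = q powi (?Q v div 5)"
      using y by (cases v) (simp add: power_int_add)
  qed
  then have "(\<lambda>n. real (card {v \<in> ?A. ?Q v div 5 = int n}) * q ^ n) sums (((?R 0)\<^sup>2 + 8 * (?R 1 * ?R 2)) * theta_all q)"
    by (rule counting_series_sums[OF _ q(1)]) (auto simp: pos_imp_zdiv_nonneg_iff)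
  moreover have "{v \<in> ?A. ?Q v div 5 = int n} = {v. ternary_form 1 1 5 0 0 0 v = 5 * int n}" for n
  proof -
    have "ternary_form 1 1 5 0 0 0 v = ?Q v" for v
      by (cases v) (simp add: ternary_form_def)
    moreover have "m mod 5 = 0 \<and> m div 5 = k \<longleftrightarrow> m = 5 * k" for m k :: int
      by presburger
    ultimately show ?thesis
      by (simp only: mem_Collect_eq)
  qed
  moreover have "((?R 0)\<^sup>2 + 8 * (?R 1 * ?R 2)) * theta_all q =
      2 * (theta_all q * theta_all q * theta_all q) - theta_all q * theta_all (q ^ 5) * theta_all (q ^ 5)"
  proof -
    have "theta_all (q ^ 5) = ?R 0"
      unfolding yq using all_weight.residue_theta_0[OF y] by (simp flip: power_mult)
    then show ?thesis
      using all_weight.theta_square_dissection[OF y, folded yq]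
      by (simp add: power2_eq_square algebra_simps)
  qed
  ultimately have "(\<lambda>n. real (rep_count 1 1 5 0 0 0 (5 * int n)) * q ^ n) sums
     (2 * (theta_all q * theta_all q * theta_all q) - theta_all q * theta_all (q ^ 5) * theta_all (q ^ 5))"
    by (simp add: rep_count_def)
  moreover have "(\<lambda>n. 2 * (real (rep_count 1 1 1 0 0 0 (int n)) * q ^ n) - real (rep_count 1 5 5 0 0 0 (int n)) * q ^ n) sums
     (2 * (theta_all q * theta_all q * theta_all q) - theta_all q * theta_all (q ^ 5) * theta_all (q ^ 5))"
    using diagonal_form_sums[of 1 1 1, OF _ _ _ q] diagonal_form_sums[of 1 5 5, OF _ _ _ q]
    by (intro sums_diff sums_mult) simp_all
  ultimately show "\<exists>S. (\<lambda>n. real (rep_count 1 1 5 0 0 0 (5 * int n)) * q ^ n) sums S \<and>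
      (\<lambda>n. (2 * real (rep_count 1 1 1 0 0 0 (int n)) - real (rep_count 1 5 5 0 0 0 (int n))) * q ^ n) sums S"
    by (auto simp: left_diff_distrib mult.assoc)
qed simp

section \<open>Theta products for the two non-diagonal forms\<close>

definition double_weight :: "(int \<Rightarrow> real) \<Rightarrow> int \<Rightarrow> real" where
  "double_weight f n = (if even n then f (n div 2) else 0)"

lemma unit_bounded_double_weight: "unit_bounded f \<Longrightarrow> unit_bounded (double_weight f)"
  by (auto simp: unit_bounded_def double_weight_def)

lemma theta_double_weight:
  "unit_bounded f \<Longrightarrow> 0 < a \<Longrightarrow> a < 1 \<Longrightarrow> theta (double_weight f) a = theta f (a ^ 4)"
  by (rule theta_double) (auto simp: double_weight_def)

text \<open>In terms of \<open>U = y + t\<close>, \<open>V = y - t\<close> and \<open>X = 4 x + U\<close>, eight times the form is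
  \<open>X\<^sup>2 + 5 U\<^sup>2 + 10 V\<^sup>2\<close>.\<close>

lemma form_222_sums:
  assumes z: "0 < z" "z < 1"
  shows "(\<lambda>n. real (rep_count 2 2 2 (-1) 1 1 (int n)) * (z ^ 8) ^ n) sums
    (theta3 (z ^ 4) * theta3 (z ^ 20) * theta3 (z ^ 10) + theta2 (z ^ 4) * theta2 (z ^ 20) * theta3 (z ^ 10) +
     theta2 z * theta2 (z ^ 5) * theta2 (z ^ 10) / 2)" (is "_ sums ?S")
proof -
  have pow: "0 < z ^ k" "z ^ k < 1" if "0 < k" for k
    using z that by (auto simp: power_less_one_iff)
  let ?p = "\<lambda>(X, U, V). z powi X\<^sup>2 * (z ^ 5) powi U\<^sup>2 * (z ^ 10) powi V\<^sup>2"
  let ?L = "{(X :: int, U, V). 4 dvd X - U \<and> even (U - V)}"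
  let ?Q = "ternary_form 2 2 2 (-1) 1 1"
  define w where "w = (\<lambda>f g h (X :: int, U :: int, V :: int). (f X * g U * h V :: real))"
  \<comment> \<open>The indicator of \<open>?L\<close> as a sum of product weights: X and U both
    divisible by 4, both congruent to 2 modulo 4, or both odd. In the last case the factor (1 + chi4
    X chi4 U) / 2 selects X \<equiv> U (mod 4).\<close>
  let ?w = "\<lambda>v. w (double_weight even_weight) (double_weight even_weight) even_weight v +
    w (double_weight odd_weight) (double_weight odd_weight) even_weight v +
    1 / 2 * w odd_weight odd_weight odd_weight v + 1 / 2 * w chi4 chi4 odd_weight v"
  have w_sum: "((\<lambda>v. w f g h v * ?p v) has_sum theta f z * theta g (z ^ 5) * theta h (z ^ 10)) UNIV"
    if "unit_bounded f" "unit_bounded g" "unit_bounded h" for f g h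
    using has_sum_theta_triple[OF that z pow[of 5] pow[of 10]] by (simp add: w_def case_prod_unfold)
  have "((\<lambda>v. w (double_weight even_weight) (double_weight even_weight) even_weight v * ?p v +
      w (double_weight odd_weight) (double_weight odd_weight) even_weight v * ?p v +
      1 / 2 * (w odd_weight odd_weight odd_weight v * ?p v) + 1 / 2 * (w chi4 chi4 odd_weight v * ?p v)) has_sum
    (theta (double_weight even_weight) z * theta (double_weight even_weight) (z ^ 5) * theta3 (z ^ 10) +
     theta (double_weight odd_weight) z * theta (double_weight odd_weight) (z ^ 5) * theta3 (z ^ 10) +
     1 / 2 * (theta2 z * theta2 (z ^ 5) * theta2 (z ^ 10)) +
     1 / 2 * (theta chi4 z * theta chi4 (z ^ 5) * theta2 (z ^ 10)))) UNIV"
    by (intro has_sum_add has_sum_cmult_right w_sum unit_bounded_double_weight unit_bounded_weights)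
  then have "((\<lambda>v. ?w v * ?p v) has_sum ?S) UNIV"
    by (simp add: distrib_right theta_chi4 theta_double_weight unit_bounded_weights z pow flip: power_mult)
  then have "(?p has_sum ?S) ?L"
  proof (rule has_sum_cong_neutral[THEN iffD1, rotated -1])
    have *: "?w (X, U, V) = of_bool (4 dvd X - U \<and> even (U - V))" for X U V
    proof -
      consider k l where "X = 2 * k" "U = 2 * l" | k l where "X = 2 * k + 1" "U = 2 * l + 1" | "odd (X - U)"
        by (metis evenE oddE odd_add even_diff)
      then show ?thesis
      proof cases
        case 1
        then have "4 dvd X - U \<longleftrightarrow> even (k - l)" by presburger
        with 1 show ?thesis
          by (simp add: w_def double_weight_def even_weight_def odd_weight_def chi4_def)
      next
        case 2
        then have "4 dvd X - U \<longleftrightarrow> even (k - l)" by presburger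
        with 2 show ?thesis
          by (simp add: w_def double_weight_def even_weight_def odd_weight_def parity_sign_def)
      next
        case 3
        then have "\<not> 4 dvd X - U" by presburger
        with 3 show ?thesis
          by (auto simp: w_def double_weight_def even_weight_def odd_weight_def chi4_def)
      qed
    qed
    show "?w v * ?p v = 0" if "v \<in> UNIV - ?L" for v
      using that by (cases v) (simp only: *, simp)
    show "?w v * ?p v = ?p v" if "v \<in> UNIV \<inter> ?L" for v
      using that by (cases v) (simp only: *, simp)
  qed auto
  then have "((\<lambda>v. (z ^ 8) powi ?Q v) has_sum ?S) UNIV"
  proof (rule has_sum_reindexI[where j = "\<lambda>(x, y, t). (4 * x + (y + t), y + t, y - t)"
        and i = "\<lambda>(X, U, V). ((X - U) div 4, (U + V) div 2, (U - V) div 2)"], goal_cases)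
    case (5 v)
    obtain x y t where v: "v = (x, y, t)" by (cases v) force
    have "8 * ?Q v = (4 * x + (y + t))\<^sup>2 + 5 * (y + t)\<^sup>2 + 10 * (y - t)\<^sup>2"
      by (simp add: v ternary_form_def power2_eq_square algebra_simps)
    then have "(z ^ 8) powi ?Q v = z powi ((4 * x + (y + t))\<^sup>2 + 5 * (y + t)\<^sup>2 + 10 * (y - t)\<^sup>2)"
      by (simp add: power_int_power)
    then show ?case
      using z by (simp add: v power_int_power power_int_add)
  qed (auto; presburger)+
  moreover have "0 \<le> ?Q v" for v
  proof -
    obtain x y t where v: "v = (x, y, t)" by (cases v) force
    have "8 * ?Q v = (4 * x + (y + t))\<^sup>2 + 5 * (y + t)\<^sup>2 + 10 * (y - t)\<^sup>2"
      by (simp add: v ternary_form_def power2_eq_square algebra_simps)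
    also have "\<dots> \<ge> 0" by simp
    finally show ?thesis by simp
  qed
  ultimately show ?thesis
    using counting_series_sums[of "z ^ 8" ?Q UNIV ?S] z by (simp add: rep_count_def)
qed

text \<open>In terms of \<open>X = 3 x + y + t\<close>, \<open>W = x + y + t\<close> and \<open>V = y - t\<close>, eight times the form is
  \<open>4 X\<^sup>2 + 20 W\<^sup>2 + 40 V\<^sup>2\<close>.\<close>

lemma form_788_sums:
  assumes z: "0 < z" "z < 1"
  shows "(\<lambda>n. real (rep_count 7 8 8 (-4) 8 8 (int n)) * (z ^ 8) ^ n) sums
    ((theta3 (z ^ 4) * theta3 (z ^ 20) * theta3 (z ^ 10) + theta4 (z ^ 4) * theta4 (z ^ 20) * theta4 (z ^ 10) +
      theta2 (z ^ 4) * theta2 (z ^ 20) * theta3 (z ^ 10)) / 2)" (is "_ sums ?S")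
proof -
  have pow: "0 < z ^ k" "z ^ k < 1" if "0 < k" for k
    using z that by (auto simp: power_less_one_iff)
  let ?p = "\<lambda>(X, W, V). (z ^ 4) powi X\<^sup>2 * (z ^ 20) powi W\<^sup>2 * (z ^ 40) powi V\<^sup>2"
  let ?L = "{(X :: int, W, V). even (X - W) \<and> even (W - (X - W) div 2 - V)}"
  let ?Q = "ternary_form 7 8 8 (-4) 8 8"
  define w where "w = (\<lambda>f g h (X :: int, W :: int, V :: int). (f X * g W * h V :: real))"
  \<comment> \<open>For X = 2 k, W = 2 l the lattice condition is that k + l + V is even; for X = 2
    k + 1, W = 2 l + 1 it is odd. Hence the factors (1 \<plusminus> (-1)^(k + l + V)) / 2, the minus
    sign belonging to the \<open>chi4\<close> term.\<close>
  let ?w = "\<lambda>v. 1 / 2 * w even_weight even_weight (\<lambda>_. 1) v + 1 / 2 * w alt_weight alt_weight parity_sign v +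
    1 / 2 * w odd_weight odd_weight (\<lambda>_. 1) v + - 1 / 2 * w chi4 chi4 parity_sign v"
  have w_sum: "((\<lambda>v. w f g h v * ?p v) has_sum theta f (z ^ 4) * theta g (z ^ 20) * theta h (z ^ 40)) UNIV"
    if "unit_bounded f" "unit_bounded g" "unit_bounded h" for f g h
    using has_sum_theta_triple[OF that pow[of 4] pow[of 20] pow[of 40]] by (simp add: w_def case_prod_unfold)
  have "((\<lambda>v. 1 / 2 * (w even_weight even_weight (\<lambda>_. 1) v * ?p v) +
      1 / 2 * (w alt_weight alt_weight parity_sign v * ?p v) +
      1 / 2 * (w odd_weight odd_weight (\<lambda>_. 1) v * ?p v) + - 1 / 2 * (w chi4 chi4 parity_sign v * ?p v)) has_sum
    (1 / 2 * (theta3 (z ^ 4) * theta3 (z ^ 20) * theta_all (z ^ 40)) +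
     1 / 2 * (theta4 (z ^ 4) * theta4 (z ^ 20) * theta parity_sign (z ^ 40)) +
     1 / 2 * (theta2 (z ^ 4) * theta2 (z ^ 20) * theta_all (z ^ 40)) +
     - 1 / 2 * (theta chi4 (z ^ 4) * theta chi4 (z ^ 20) * theta parity_sign (z ^ 40)))) UNIV"
    by (intro has_sum_add has_sum_cmult_right w_sum unit_bounded_weights)
  moreover have "theta_all (z ^ 40) = theta3 (z ^ 10)" "theta parity_sign (z ^ 40) = theta4 (z ^ 10)"
    using theta_all_fourth_power[of "z ^ 10"] theta_sign_fourth_power[of "z ^ 10"] pow[of 10]
    by (simp_all flip: power_mult)
  ultimately have "((\<lambda>v. ?w v * ?p v) has_sum ?S) UNIV"
    by (simp add: theta_chi4 algebra_simps add_divide_distrib)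
  then have "(?p has_sum ?S) ?L"
  proof (rule has_sum_cong_neutral[THEN iffD1, rotated -1])
    have *: "?w (X, W, V) = of_bool (even (X - W) \<and> even (W - (X - W) div 2 - V))" for X W V
    proof -
      consider k l where "X = 2 * k" "W = 2 * l" | k l where "X = 2 * k + 1" "W = 2 * l + 1" | "odd (X - W)"
        by (metis evenE oddE odd_add even_diff)
      then show ?thesis
      proof cases
        case 1
        then have "even (W - (X - W) div 2 - V) \<longleftrightarrow> even (k + l + V)" by presburger
        with 1 show ?thesis
          by (simp add: w_def even_weight_def odd_weight_def chi4_def parity_sign_def)
      next
        case 2
        then have "even (W - (X - W) div 2 - V) \<longleftrightarrow> odd (k + l + V)" by presburger
        with 2 show ?thesis
          by (simp add: w_def even_weight_def odd_weight_def alt_weight_def parity_sign_def)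
      next
        case 3
        then show ?thesis
          by (auto simp: w_def even_weight_def odd_weight_def chi4_def alt_weight_def)
      qed
    qed
    show "?w v * ?p v = 0" if "v \<in> UNIV - ?L" for v
      using that by (cases v) (simp only: *, simp)
    show "?w v * ?p v = ?p v" if "v \<in> UNIV \<inter> ?L" for v
      using that by (cases v) (simp only: *, simp)
  qed auto
  then have "((\<lambda>v. (z ^ 8) powi ?Q v) has_sum ?S) UNIV"
  proof (rule has_sum_reindexI[where j = "\<lambda>(x, y, t). (3 * x + y + t, x + y + t, y - t)"
        and i = "\<lambda>(X, W, V). let x = (X - W) div 2; U = W - x in (x, (U + V) div 2, (U - V) div 2)"], goal_cases)
    case (1 v)
    obtain x y t where v: "v = (x, y, t)" by (cases v) force
    have "3 * x + y + t - (x + y + t) = x * 2" "x + y + t - x + (y - t) = y * 2" "x + y + t - x - (y - t) = t * 2"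
      by simp_all
    then show ?case
      unfolding v prod.case Let_def by (simp only: nonzero_mult_div_cancel_right zero_neq_numeral[symmetric] not_False_eq_True)
  next
    case (2 v)
    obtain x y t where v: "v = (x, y, t)" by (cases v) force
    have "3 * x + y + t - (x + y + t) = x * 2" "x + y + t - x - (y - t) = t * 2"
      by simp_all
    then show ?case
      unfolding v prod.case mem_Collect_eq by (simp only: nonzero_mult_div_cancel_right zero_neq_numeral[symmetric] not_False_eq_True) simp
  next
    case (3 b)
    obtain X W V where b: "b = (X, W, V)" by (cases b) force
    have even: "even (X - W)" "even (W - (X - W) div 2 - V)"
      using 3 unfolding b by simp_all
    obtain x where "X - W = 2 * x"
      using even(1) by (rule evenE)
    then have x: "X = W + 2 * x" by simp
    obtain t where "W - (X - W) div 2 - V = 2 * t"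
      using even(2) by (rule evenE)
    then have t: "W = x + V + 2 * t" by (simp add: x)
    show ?case
      unfolding b Let_def by (simp add: x t)
  next
    case (5 v)
    obtain x y t where v: "v = (x, y, t)" by (cases v) force
    have "8 * ?Q v = 4 * (3 * x + y + t)\<^sup>2 + 20 * (x + y + t)\<^sup>2 + 40 * (y - t)\<^sup>2"
      by (simp add: v ternary_form_def power2_eq_square algebra_simps)
    then have "(z ^ 8) powi ?Q v = z powi (4 * (3 * x + y + t)\<^sup>2 + 20 * (x + y + t)\<^sup>2 + 40 * (y - t)\<^sup>2)"
      by (simp add: power_int_power)
    then show ?case
      using z by (simp add: v power_int_power power_int_add)
  qed simp
  moreover have "0 \<le> ?Q v" for v
  proof -
    obtain x y t where v: "v = (x, y, t)" by (cases v) force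
    have "8 * ?Q v = 4 * (3 * x + y + t)\<^sup>2 + 20 * (x + y + t)\<^sup>2 + 40 * (y - t)\<^sup>2"
      by (simp add: v ternary_form_def power2_eq_square algebra_simps)
    also have "\<dots> \<ge> 0" by simp
    finally show ?thesis by simp
  qed
  ultimately show ?thesis
    using counting_series_sums[of "z ^ 8" ?Q UNIV ?S] z by (simp add: rep_count_def)
qed

text \<open>In this combination of the two forms the products shared by \<open>form_222_sums\<close>
  and \<open>form_788_sums\<close> cancel, leaving the right-hand side of
  \<open>theta_quintic_identity\<close>. The radius (1/2)^40 corresponds to w < 1/2 under q =
  w^40.\<close>

lemma three_squares_minus_155:
  "real (rep_count 1 1 1 0 0 0 (int n)) - 3 * real (rep_count 1 5 5 0 0 0 (int n)) =
    2 * real (rep_count 2 2 2 (-1) 1 1 (int n)) - 4 * real (rep_count 7 8 8 (-4) 8 8 (int n))"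
proof (rule power_series_coeffs_eq[of "(1 / 2) ^ 40"
      "\<lambda>n. real (rep_count 1 1 1 0 0 0 (int n)) - 3 * real (rep_count 1 5 5 0 0 0 (int n))"
      "\<lambda>n. 2 * real (rep_count 2 2 2 (-1) 1 1 (int n)) - 4 * real (rep_count 7 8 8 (-4) 8 8 (int n))"])
  fix q :: real
  assume q: "0 < q" "q < (1 / 2) ^ 40"
  define w where "w = root 40 q"
  have w: "0 < w" "q = w ^ 40"
    using q by (auto simp: w_def)
  have "w < 1 / 2"
    using q(2) w power_less_imp_less_base[of w 40 "1 / 2"] by simp
  then have w2: "w \<le> 1 / 2" by simp
  have pow: "0 < w ^ k" "w ^ k < 1" if "0 < k" for k
    using w w2 that by (auto simp: power_less_one_iff)
  have q1: "q < 1" using pow[of 40] w by simp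
  have T: "theta_all q = theta3 (w ^ 10)" "theta_all (q ^ 5) = theta3 (w ^ 50)"
    using theta_all_fourth_power[of "w ^ 10"] theta_all_fourth_power[of "w ^ 50"] pow[of 10] pow[of 50]
    by (simp_all add: w(2) flip: power_mult)
  define S where "S = theta3 (w ^ 10) ^ 3 - 3 * theta3 (w ^ 10) * (theta3 (w ^ 50))\<^sup>2"
  have "(\<lambda>n. real (rep_count 1 1 1 0 0 0 (int n)) * q ^ n - 3 * (real (rep_count 1 5 5 0 0 0 (int n)) * q ^ n)) sums
      (theta_all q * theta_all q * theta_all q - 3 * (theta_all q * theta_all (q ^ 5) * theta_all (q ^ 5)))"
    using diagonal_form_sums[of 1 1 1, OF _ _ _ q(1) q1] diagonal_form_sums[of 1 5 5, OF _ _ _ q(1) q1]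
    by (intro sums_diff sums_mult) simp_all
  moreover have "theta_all q * theta_all q * theta_all q - 3 * (theta_all q * theta_all (q ^ 5) * theta_all (q ^ 5)) = S"
    unfolding T S_def by (simp add: eval_nat_numeral)
  ultimately have 1: "(\<lambda>n. (real (rep_count 1 1 1 0 0 0 (int n)) - 3 * real (rep_count 1 5 5 0 0 0 (int n))) * q ^ n) sums S"
    by (simp add: left_diff_distrib mult.assoc)
  define z where "z = w ^ 5"
  have z: "0 < z" "z < 1" using pow[of 5] by (auto simp: z_def)
  have zq: "z ^ 8 = q" by (simp add: z_def w(2) flip: power_mult)
  have zw: "z ^ 4 = w ^ 20" "z ^ 20 = w ^ 100" "z ^ 10 = w ^ 50" "z ^ 5 = w ^ 25"
    by (simp_all add: z_def flip: power_mult)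
  have "(\<lambda>n. 2 * (real (rep_count 2 2 2 (-1) 1 1 (int n)) * q ^ n) - 4 * (real (rep_count 7 8 8 (-4) 8 8 (int n)) * q ^ n)) sums
      (theta2 z * theta2 (z ^ 5) * theta2 (z ^ 10) - 2 * (theta4 (z ^ 4) * theta4 (z ^ 20)) * theta4 (z ^ 10))"
    by (rule sums_diff[OF sums_mult[OF form_222_sums[OF z]] sums_mult[OF form_788_sums[OF z]], of 2 4, unfolded zq, THEN back_subst[of "\<lambda>s. _ sums s"]])
      (simp add: algebra_simps add_divide_distrib)
  moreover have "theta2 z * theta2 (z ^ 5) * theta2 (z ^ 10) - 2 * (theta4 (z ^ 4) * theta4 (z ^ 20)) * theta4 (z ^ 10) = S"
    unfolding zw S_def using theta_quintic_identity[OF w(1) w2] by (simp add: z_def)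
  ultimately have 2: "(\<lambda>n. (2 * real (rep_count 2 2 2 (-1) 1 1 (int n)) - 4 * real (rep_count 7 8 8 (-4) 8 8 (int n))) * q ^ n) sums S"
    by (simp add: left_diff_distrib mult.assoc)
  from 1 2 show "\<exists>S. (\<lambda>n. (real (rep_count 1 1 1 0 0 0 (int n)) - 3 * real (rep_count 1 5 5 0 0 0 (int n))) * q ^ n) sums S \<and>
      (\<lambda>n. (2 * real (rep_count 2 2 2 (-1) 1 1 (int n)) - 4 * real (rep_count 7 8 8 (-4) 8 8 (int n))) * q ^ n) sums S"
    by blast
qed simp

theorem theorem5p3:
  fixes n :: int
  assumes "n \<ge> 0"
  shows "int (sum3sq_count (25 * n)) - 5 * int (sum3sq_count n) =
    4 * int (rep_count 2 2 2 (-1) 1 1 n) - 8 * int (rep_count 7 8 8 (-4) 8 8 n)"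
proof -
  obtain m where n: "n = int m"
    using assms nonneg_int_cases by blast
  have sq: "sum3sq_count k = rep_count 1 1 1 0 0 0 k" for k
    by (auto simp: sum3sq_count_def rep_count_def ternary_form_def intro!: arg_cong[where f = card])
  have "rep_count 5 5 5 0 0 0 (5 * n) = rep_count 1 1 1 0 0 0 n"
    by (auto simp: rep_count_def ternary_form_def intro!: arg_cong[where f = card])
  \<comment> \<open>The first recurrence at 5 n and the second at n give 6 (2 s - (1,5,5,0,0,0)) - 5
    s, all counts taken at n. Subtracting 5 s leaves twice the left-hand side of
    \<open>three_squares_minus_155\<close>.\<close>
  then have "real (rep_count 1 1 1 0 0 0 (25 * n)) =
      7 * real (rep_count 1 1 1 0 0 0 n) - 6 * real (rep_count 1 5 5 0 0 0 n)"
    using rep_count_111_mult_5[of "5 * m"] rep_count_115_mult_5[of m] by (simp add: n)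
  then have "real (sum3sq_count (25 * n)) - 5 * real (sum3sq_count n) =
      4 * real (rep_count 2 2 2 (-1) 1 1 n) - 8 * real (rep_count 7 8 8 (-4) 8 8 n)"
    unfolding sq using three_squares_minus_155[of m] by (simp add: n)
  then have "of_int (int (sum3sq_count (25 * n)) - 5 * int (sum3sq_count n)) =
      (of_int (4 * int (rep_count 2 2 2 (-1) 1 1 n) - 8 * int (rep_count 7 8 8 (-4) 8 8 n)) :: real)"
    by simp
  then show ?thesis
    by (rule of_int_eq_iff[THEN iffD1])
qed

end
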